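(* For each $n\ge 1$ let $G_n$ be a random simple graph on the vertex set $[n]$, sampled according to some probability distribution over the set of all simple graphs on $[n]$, and let $c=c(n)$ be positive integers with $c(n)\to\infty$ and $|E(G_n)|/c\to\infty$ in probability. Let $N(G_n)$ be the number of monochromatic edges when the vertices of $G_n$ are colored independently and uniformly at random with $c$ colors (independently of $G_n$). Then $$\frac{1}{\sqrt{|E(G_n)|/c}}\left(N(G_n)-\frac{|E(G_n)|}{c}\right)\to N(0,1)$$ in distribution as $n\to\infty$.
   Context: $[n]=\{1,\dots,n\}$; $E(G_n)$ is the edge set of $G_n$. The colors $Y_1,\dots,Y_n$ of the vertices are i.i.d. uniform on $\{1,\dots,c\}$ and independent of $G_n$, and $N(G_n)=\sum_{(i,j)\in E(G_n)}\mathbf{1}\{Y_i=Y_j\}$. Deterministic graph sequences are included as a special case. The normalized variable is defined when $|E(G_n)|>0$, an event of probability tending to $1$. *)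

theory Defs
  imports "HOL-Probability.Probability"
begin

text \<open>
  A simple graph on the fixed vertex set \<open>{1..n}\<close> is identified with its edge set, a set of
  two-element subsets of \<open>{1..n}\<close>; each undirected edge is therefore counted exactly once.
\<close>

definition simple_graphs :: "nat \<Rightarrow> nat set set set" where
  "simple_graphs n = Pow {e. e \<subseteq> {1..n} \<and> card e = 2}"

definition uniform_colouring :: "nat \<Rightarrow> nat \<Rightarrow> (nat \<Rightarrow> nat) pmf" where
  "uniform_colouring n c = Pi_pmf {1..n} undefined (\<lambda>_. pmf_of_set {1..c})"

definition coloured_graph :: "nat set set pmf \<Rightarrow> nat \<Rightarrow> nat \<Rightarrow> (nat set set \<times> (nat \<Rightarrow> nat)) pmf" where
  "coloured_graph G n c = pair_pmf G (uniform_colouring n c)"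

definition mono_edges :: "nat set set \<Rightarrow> (nat \<Rightarrow> nat) \<Rightarrow> nat" where
  "mono_edges E Y = (\<Sum>e\<in>E. of_bool (\<forall>i\<in>e. \<forall>j\<in>e. Y i = Y j))"

text \<open>
  On the event that the graph has no edges, where the normalisation is undefined on paper,
  the following takes the value 0 by the convention \<open>x / 0 = 0\<close>.
\<close>

definition normalised_mono_edges :: "nat \<Rightarrow> nat set set \<times> (nat \<Rightarrow> nat) \<Rightarrow> real" where
  "normalised_mono_edges c = (\<lambda>(E, Y).
     1 / sqrt (real (card E) / real c) * (real (mono_edges E Y) - real (card E) / real c))"

definition tends_to_infinity_in_prob :: "(nat \<Rightarrow> 'a pmf) \<Rightarrow> (nat \<Rightarrow> 'a \<Rightarrow> real) \<Rightarrow> bool" where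
  "tends_to_infinity_in_prob M X \<longleftrightarrow>
     (\<forall>K. (\<lambda>n. measure_pmf.prob (M n) {x. X n x > K}) \<longlonglongrightarrow> 1)"

end

theory Submission
  imports Defs "HOL-Real_Asymp.Real_Asymp"
begin

text \<open>
  Fix a graph with \<open>m\<close> edges, \<open>c\<close> colours, and reveal the colours of the vertices one at a time.
  When vertex \<open>k\<close> receives its colour, the number of monochromatic edges grows by the number of
  earlier neighbours that share it; the centred growth
  \<open>D\<^sub>k = \<Sum>\<^sub>j (1{Y\<^sub>j = Y\<^sub>k} - 1/c)\<close>, with \<open>j\<close> running over the earlier neighbours, has conditional
  mean \<open>0\<close>, because every colour \<open>Y\<^sub>j\<close> is hit with probability \<open>1/c\<close>.
  So \<open>N - m/c\<close> is a martingale, and a martingale is asymptotically normal as soon as its increments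
  are small and its conditional variances add up to almost a constant. Both hold here once divided
  by the right power of \<open>\<sigma> = sqrt (m/c)\<close>.

  Small increments. The order of the vertices matters: in a star whose centre is revealed last, the
  whole fluctuation sits in one increment. Revealing the vertices by decreasing degree cures this: if
  \<open>k\<close> has \<open>d\<^sub>k\<close> earlier neighbours, each of them has degree at least \<open>d\<^sub>k\<close>, so \<open>d\<^sub>k\<^sup>2 \<le> 2m\<close>
  (\<open>back_degree_square_le\<close>). Given \<open>Y\<^sub>k\<close>, the increment is a centred binomial variable, whose fourth
  moment is at most \<open>3 d\<^sub>k\<^sup>2 / c\<^sup>2 + d\<^sub>k / c\<close> (\<open>excess_sum_moments\<close>). Since \<open>\<Sum> d\<^sub>k = m\<close>, the sum of
  the fourth moments of \<open>D\<^sub>k / \<sigma>\<close> is of order \<open>1 / sqrt m + c / m\<close>.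

  Conditional variances. Their sum is a constant plus a weighted sum of the variables
  \<open>1{Y\<^sub>j = Y\<^sub>l} - 1/c\<close> over pairs, the weight counting the common later neighbours of \<open>j\<close> and \<open>l\<close>.
  These variables are pairwise uncorrelated, even for pairs that share a vertex
  (\<open>weighted_excess_variance\<close>), and the squared weights sum to at most \<open>m\<^sup>2\<close>, as each configuration
  counted is determined by two edges (\<open>sum_codegree_squares_le\<close>). After normalisation the variance
  of the sum is at most \<open>4/c\<close>.

  The quantitative martingale limit theorem \<open>martingale_char_approx\<close> turns the two estimates into a
  bound on the distance between the characteristic function and \<open>exp (-t\<^sup>2/2)\<close> which depends on the
  graph only through \<open>m/c\<close> and decreases in it (\<open>graph_char_bound\<close>). It may therefore be
  averaged over a random graph, the event that \<open>m/c\<close> is below a threshold being charged with its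
  probability (\<open>random_graph_char_bound\<close>), and Levy's continuity theorem concludes.
\<close>

section \<open>A quantitative martingale central limit theorem\<close>

text \<open>
  A history \<open>h\<close> plays the role of a sigma-algebra: on a finitely supported space, a function is
  measurable with respect to the information in \<open>h\<close> exactly if it factors through \<open>h\<close>.
\<close>

definition determined_by :: "('a \<Rightarrow> 'h) \<Rightarrow> ('a \<Rightarrow> 'b) \<Rightarrow> bool" where
  "determined_by h g \<longleftrightarrow> (\<forall>x y. h x = h y \<longrightarrow> g x = g y)"

lemma exp_minus_linear_bound:
  fixes y :: real
  assumes "y \<ge> 0"
  shows "\<bar>exp (-y) - (1 - y)\<bar> \<le> y\<^sup>2 / 2"
proof -
  have pos: "1 + y + y\<^sup>2 / 2 > 0" using assms by (simp add: add_pos_nonneg)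
  have "exp (-y) = 1 / exp y" by (simp add: exp_minus inverse_eq_divide)
  also have "\<dots> \<le> 1 / (1 + y + y\<^sup>2 / 2)"
    using exp_lower_Taylor_quadratic[OF assms] pos by (intro divide_left_mono) auto
  also have "\<dots> \<le> 1 - y + y\<^sup>2 / 2"
  proof -
    have "(1 - y + y\<^sup>2 / 2) * (1 + y + y\<^sup>2 / 2) = 1 + (y\<^sup>2)\<^sup>2 / 4"
      by (simp add: power2_eq_square field_simps)
    then have "1 \<le> (1 - y + y\<^sup>2 / 2) * (1 + y + y\<^sup>2 / 2)" by simp
    then show ?thesis using pos by (simp add: pos_divide_le_eq)
  qed
  finally have "exp (-y) - (1 - y) \<le> y\<^sup>2 / 2" by simp
  moreover have "0 \<le> exp (-y) - (1 - y)"
    using exp_ge_add_one_self[of "-y"] by simp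
  ultimately show ?thesis by simp
qed

lemma iexp_quadratic_bound: "cmod (iexp x - (1 + \<i> * x - x\<^sup>2 / 2)) \<le> \<bar>x\<bar>^3 / 6"
proof -
  have "(\<Sum>k\<le>2. (\<i> * complex_of_real x)^k / fact k) = 1 + \<i> * x - x\<^sup>2 / 2"
    by (simp add: numeral_2_eq_2 power_mult_distrib)
  moreover have "Suc 2 = 3" "fact 3 = (6::real)" by (simp_all add: fact_numeral)
  ultimately show ?thesis
    using iexp_approx1[of x 2] by simp
qed

lemma abs_cube_le:
  fixes x e :: real
  assumes "e > 0"
  shows "\<bar>x\<bar>^3 \<le> (e * x\<^sup>2 + x^4 / e) / 2"
proof -
  define a where "a = \<bar>x\<bar>"
  have x: "x\<^sup>2 = a * a" "x^4 = a * a * a * a" "\<bar>x\<bar>^3 = a * a * a"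
    by (simp_all add: a_def eval_nat_numeral)
  have "0 \<le> (a * (e - a)) * (a * (e - a))" by simp
  then have "2 * e * (a * a * a) \<le> e * e * (a * a) + a * a * a * a" by (simp add: algebra_simps)
  then show ?thesis unfolding x using assms by (simp add: field_simps)
qed

text \<open>
  Here \<open>h k\<close> is what is known before step \<open>k\<close>, \<open>D k\<close> is a martingale difference and \<open>v k\<close> its
  conditional variance; conditional expectations are expressed by testing against the functions
  of the history. With \<open>S k\<close> and \<open>V k\<close> the partial sums of \<open>D\<close> and \<open>v\<close>, the proof interpolates
  by \<open>B k = iexp (t * S k) * exp (- t\<^sup>2 * max 0 (1 - V k) / 2)\<close>: the variance that is still missing
  to \<open>1\<close> is supplied by a fictitious independent Gaussian variable. \<open>B 0\<close> is the constant
  \<open>exp (- t\<^sup>2 / 2)\<close>, and \<open>B n\<close> is the variable of interest up to the missing variance. One step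
  exchanges \<open>D k\<close> for a Gaussian variable of variance \<open>v k\<close>, or less once the budget \<open>1\<close> is
  exhausted, so that the expectation changes by third and fourth order terms and by the overshoot of
  the budget. Truncating at \<open>0\<close> keeps all factors bounded by \<open>1\<close>, whatever the total
  conditional variance is. The free parameter \<open>e\<close> interpolates the third moments
  between the second and the fourth.
\<close>

lemma martingale_char_approx:
  fixes M :: "'a pmf" and h :: "nat \<Rightarrow> 'a \<Rightarrow> 'h" and D v :: "nat \<Rightarrow> 'a \<Rightarrow> real" and n :: nat and t e :: real
  assumes fin: "finite (set_pmf M)"
    and adapted: "\<And>j k. j < k \<Longrightarrow> k < n \<Longrightarrow> determined_by (h k) (D j)"
    and predictable: "\<And>j k. j \<le> k \<Longrightarrow> k < n \<Longrightarrow> determined_by (h k) (v j)"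
    and v_nonneg: "\<And>k x. v k x \<ge> 0"
    and centred: "\<And>k g. k < n \<Longrightarrow> determined_by (h k) g \<Longrightarrow>
       measure_pmf.expectation M (\<lambda>x. (g x :: complex) * of_real (D k x)) = 0"
    and variance: "\<And>k g. k < n \<Longrightarrow> determined_by (h k) g \<Longrightarrow>
       measure_pmf.expectation M (\<lambda>x. (g x :: complex) * of_real ((D k x)\<^sup>2)) =
       measure_pmf.expectation M (\<lambda>x. g x * of_real (v k x))"
    and e: "e > 0"
  defines "L4 \<equiv> (\<Sum>k<n. measure_pmf.expectation M (\<lambda>x. (D k x)^4))"
  shows "cmod (measure_pmf.expectation M (\<lambda>x. iexp (t * (\<Sum>k<n. D k x))) - exp (- (t\<^sup>2) / 2))
     \<le> t\<^sup>2 / 2 * measure_pmf.expectation M (\<lambda>x. \<bar>(\<Sum>k<n. v k x) - 1\<bar>)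
       + \<bar>t\<bar>^3 / 12 * (e * measure_pmf.expectation M (\<lambda>x. \<Sum>k<n. v k x) + L4 / e)
       + t^4 / 8 * L4"
proof -
  define E where "E f = measure_pmf.expectation M f" for f :: "'a \<Rightarrow> real"
  define Ec where "Ec f = measure_pmf.expectation M f" for f :: "'a \<Rightarrow> complex"
  have int[simp]: "integrable (measure_pmf M) f" for f :: "'a \<Rightarrow> real"
    by (rule integrable_measure_pmf_finite[OF fin])
  have intc[simp]: "integrable (measure_pmf M) f" for f :: "'a \<Rightarrow> complex"
    by (rule integrable_measure_pmf_finite[OF fin])
  have E_add: "E (\<lambda>x. f x + g x) = E f + E g" for f g by (simp add: E_def)
  have E_diff: "E (\<lambda>x. f x - g x) = E f - E g" for f g by (simp add: E_def)
  have E_cmult: "E (\<lambda>x. a * f x) = a * E f" for a f by (simp add: E_def)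
  have E_sum: "E (\<lambda>x. \<Sum>k<n. f k x) = (\<Sum>k<n. E (f k))" for f by (simp add: E_def)
  have E_mono: "E f \<le> E g" if "\<And>x. f x \<le> g x" for f g
    unfolding E_def by (rule integral_mono) (use that in auto)
  have Ec_add: "Ec (\<lambda>x. f x + g x) = Ec f + Ec g" for f g by (simp add: Ec_def)
  have Ec_diff: "Ec (\<lambda>x. f x - g x) = Ec f - Ec g" for f g by (simp add: Ec_def)
  have Ec_cmult: "Ec (\<lambda>x. a * f x) = a * Ec f" for a f by (simp add: Ec_def)
  have Ec_of_real: "Ec (\<lambda>x. of_real (f x)) = of_real (E f)" for f by (simp add: Ec_def E_def)
  have Ec_norm: "cmod (Ec f) \<le> E g" if "\<And>x. cmod (f x) \<le> g x" for f g
    unfolding Ec_def E_def by (rule order_trans[OF integral_norm_bound integral_mono]) (use that in auto)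

  define S where "S k x = (\<Sum>j<k. D j x)" for k x
  define V where "V k x = (\<Sum>j<k. v j x)" for k x
  \<comment> \<open>R is the variance budget left, r the part of it used by step k, and Z the part of the
    interpolation that step k leaves unchanged; Z depends on the history only because the
    conditional variance of step k is known in advance.\<close>
  define R where "R k x = max 0 (1 - V k x)" for k x
  define r where "r k x = R k x - R (Suc k) x" for k x
  define Z where "Z k x = iexp (t * S k x) * of_real (exp (- t\<^sup>2 * R (Suc k) x / 2))" for k x
  define B where "B k x = iexp (t * S k x) * of_real (exp (- t\<^sup>2 * R k x / 2))" for k x
  have R_nonneg: "R k x \<ge> 0" for k x by (simp add: R_def)
  have r_nonneg: "r k x \<ge> 0" and r_le: "r k x \<le> v k x" for k x
    using v_nonneg[of k x] by (auto simp: r_def R_def V_def)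
  have Z_le: "cmod (Z k x) \<le> 1" for k x
    by (simp add: Z_def norm_mult R_nonneg)
  have sums_determined: "S k x = S k y" "V (Suc k) x = V (Suc k) y"
    if "k < n" "h k x = h k y" for k x y
  proof -
    have "D j x = D j y" if "j < k" for j
      using adapted[OF that \<open>k < n\<close>] \<open>h k x = h k y\<close> unfolding determined_by_def by blast
    then show "S k x = S k y" by (simp add: S_def)
    have "v j x = v j y" if "j \<le> k" for j
      using predictable[OF that \<open>k < n\<close>] \<open>h k x = h k y\<close> unfolding determined_by_def by blast
    then show "V (Suc k) x = V (Suc k) y" by (simp add: V_def less_Suc_eq_le del: sum.lessThan_Suc)
  qed
  have Z_det: "determined_by (h k) (Z k)" if "k < n" for k
    unfolding determined_by_def Z_def R_def
  proof (intro allI impI)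
    fix x y assume "h k x = h k y"
    from sums_determined[OF \<open>k < n\<close> this]
    show "iexp (t * S k x) * of_real (exp (- t\<^sup>2 * max 0 (1 - V (Suc k) x) / 2)) =
      iexp (t * S k y) * of_real (exp (- t\<^sup>2 * max 0 (1 - V (Suc k) y) / 2))" by (simp only:)
  qed

  \<comment> \<open>Jensen's inequality for the conditional variance, by testing it against itself.\<close>
  have v_sq: "E (\<lambda>x. (v k x)\<^sup>2) \<le> E (\<lambda>x. (D k x)^4)" if k: "k < n" for k
  proof -
    have "determined_by (h k) (\<lambda>x. complex_of_real (v k x))"
      using predictable[OF order_refl k] unfolding determined_by_def by metis
    from variance[OF k this]
    have "Ec (\<lambda>x. of_real (v k x * (D k x)\<^sup>2)) = Ec (\<lambda>x. of_real ((v k x)\<^sup>2))"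
      by (simp add: Ec_def power2_eq_square)
    then have eq: "E (\<lambda>x. v k x * (D k x)\<^sup>2) = E (\<lambda>x. (v k x)\<^sup>2)"
      unfolding Ec_of_real by (simp only: of_real_eq_iff)
    have "E (\<lambda>x. 2 * (v k x * (D k x)\<^sup>2)) \<le> E (\<lambda>x. (v k x)\<^sup>2 + (D k x)^4)"
    proof (rule E_mono)
      fix x
      have "0 \<le> (v k x - (D k x)\<^sup>2)\<^sup>2" by simp
      also have "\<dots> = (v k x)\<^sup>2 + (D k x)^4 - 2 * (v k x * (D k x)\<^sup>2)"
        by (simp add: power2_eq_square power4_eq_xxxx algebra_simps)
      finally show "2 * (v k x * (D k x)\<^sup>2) \<le> (v k x)\<^sup>2 + (D k x)^4" by simp
    qed
    then show ?thesis unfolding E_cmult E_add eq by simp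
  qed
  have D_sq: "E (\<lambda>x. (D k x)\<^sup>2) = E (v k)" if k: "k < n" for k
  proof -
    have "Ec (\<lambda>x. of_real ((D k x)\<^sup>2)) = Ec (\<lambda>x. of_real (v k x))"
      using variance[OF k, of "\<lambda>_. 1"] by (simp add: Ec_def determined_by_def)
    then show ?thesis unfolding Ec_of_real by (simp only: of_real_eq_iff)
  qed

  have step: "cmod (Ec (B (Suc k)) - Ec (B k))
     \<le> \<bar>t\<bar>^3 / 12 * (e * E (v k) + E (\<lambda>x. (D k x)^4) / e) + t^4 / 8 * E (\<lambda>x. (D k x)^4)
        + t\<^sup>2 / 2 * E (\<lambda>x. v k x - r k x)" if k: "k < n" for k
  proof -
    \<comment> \<open>P and Q are the Taylor remainders of the true and of the Gaussian step.\<close>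
    define P where "P x = iexp (t * D k x) - (1 + \<i> * of_real (t * D k x) - (of_real (t * D k x))\<^sup>2 / 2)" for x
    define Q where "Q x = exp (- (t\<^sup>2 * r k x / 2)) - (1 - t\<^sup>2 * r k x / 2)" for x
    \<comment> \<open>Up to the remainders, the exact difference is of second order; its linear term has conditional
      mean 0 and its quadratic term leaves only v k - r k.\<close>
    have B_diff: "B (Suc k) x - B k x = Z k x * P x - Z k x * of_real (Q x)
        + (\<i> * t) * (Z k x * of_real (D k x))
        - (of_real (t\<^sup>2 / 2)) * (Z k x * of_real ((D k x)\<^sup>2))
        + (of_real (t\<^sup>2 / 2)) * (Z k x * of_real (r k x))" for x
    proof -
      have "B (Suc k) x = Z k x * iexp (t * D k x)"
        by (simp add: B_def Z_def S_def distrib_left exp_add)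
      moreover have "B k x = Z k x * of_real (exp (- (t\<^sup>2 * r k x / 2)))"
      proof -
        have "- t\<^sup>2 * R k x / 2 = - t\<^sup>2 * R (Suc k) x / 2 + - (t\<^sup>2 * r k x / 2)"
          by (simp add: r_def field_simps)
        then show ?thesis unfolding B_def Z_def by (simp only: exp_add of_real_mult mult.assoc)
      qed
      ultimately show ?thesis
        unfolding P_def Q_def by (simp add: algebra_simps power_mult_distrib)
    qed
    have "Ec (B (Suc k)) - Ec (B k) = Ec (\<lambda>x. B (Suc k) x - B k x)" by (simp add: Ec_diff)
    also have "\<dots> = Ec (\<lambda>x. Z k x * P x) - Ec (\<lambda>x. Z k x * of_real (Q x))
        + (\<i> * t) * Ec (\<lambda>x. Z k x * of_real (D k x))
        - (of_real (t\<^sup>2 / 2)) * Ec (\<lambda>x. Z k x * of_real ((D k x)\<^sup>2))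
        + (of_real (t\<^sup>2 / 2)) * Ec (\<lambda>x. Z k x * of_real (r k x))"
      unfolding B_diff Ec_add Ec_diff Ec_cmult ..
    also have "\<dots> = Ec (\<lambda>x. Z k x * P x) - Ec (\<lambda>x. Z k x * of_real (Q x))
        - (of_real (t\<^sup>2 / 2)) * Ec (\<lambda>x. Z k x * of_real (v k x - r k x))"
      using centred[OF k Z_det[OF k]] variance[OF k Z_det[OF k]]
      unfolding of_real_diff right_diff_distrib Ec_diff by (simp add: Ec_def algebra_simps)
    finally have eq: "Ec (B (Suc k)) - Ec (B k) = \<dots>" .
    have Z_mult: "cmod (Z k x * w) \<le> a" if "cmod w \<le> a" for x w a
      using mult_mono[OF Z_le[of k x] that] by (simp add: norm_mult)
    have "cmod (Ec (\<lambda>x. Z k x * P x)) \<le> E (\<lambda>x. \<bar>t\<bar>^3 / 12 * (e * (D k x)\<^sup>2 + (1 / e) * (D k x)^4))"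
    proof (intro Ec_norm Z_mult)
      fix x
      have "cmod (P x) \<le> \<bar>t * D k x\<bar>^3 / 6"
        unfolding P_def using iexp_quadratic_bound[of "t * D k x"] by simp
      also have "\<dots> = \<bar>t\<bar>^3 / 6 * \<bar>D k x\<bar>^3" by (simp add: abs_mult power_mult_distrib)
      also have "\<dots> \<le> \<bar>t\<bar>^3 / 6 * ((e * (D k x)\<^sup>2 + (D k x)^4 / e) / 2)"
        by (intro mult_left_mono abs_cube_le e) simp
      finally show "cmod (P x) \<le> \<bar>t\<bar>^3 / 12 * (e * (D k x)\<^sup>2 + (1 / e) * (D k x)^4)" by simp
    qed
    then have 1: "cmod (Ec (\<lambda>x. Z k x * P x)) \<le> \<bar>t\<bar>^3 / 12 * (e * E (v k) + E (\<lambda>x. (D k x)^4) / e)"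
      unfolding E_cmult E_add D_sq[OF k] by simp
    have "cmod (Ec (\<lambda>x. Z k x * of_real (Q x))) \<le> E (\<lambda>x. t^4 / 8 * (v k x)\<^sup>2)"
    proof (intro Ec_norm Z_mult)
      fix x
      have "cmod (of_real (Q x)) \<le> (t\<^sup>2 * r k x / 2)\<^sup>2 / 2"
        unfolding Q_def norm_of_real by (rule exp_minus_linear_bound) (simp add: r_nonneg)
      also have "\<dots> \<le> (t\<^sup>2 * v k x / 2)\<^sup>2 / 2"
        by (intro divide_right_mono power_mono mult_left_mono) (auto simp: r_le r_nonneg)
      also have "\<dots> = t^4 / 8 * (v k x)\<^sup>2"
        by (simp add: power2_eq_square power4_eq_xxxx)
      finally show "cmod (of_real (Q x)) \<le> t^4 / 8 * (v k x)\<^sup>2" .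
    qed
    also have "\<dots> \<le> t^4 / 8 * E (\<lambda>x. (D k x)^4)"
      unfolding E_cmult by (intro mult_left_mono v_sq k) simp
    finally have 2: "cmod (Ec (\<lambda>x. Z k x * of_real (Q x))) \<le> t^4 / 8 * E (\<lambda>x. (D k x)^4)" .
    have 3: "cmod (Ec (\<lambda>x. Z k x * of_real (v k x - r k x))) \<le> E (\<lambda>x. v k x - r k x)"
      by (intro Ec_norm Z_mult) (simp add: r_le flip: of_real_diff)
    have "cmod (Ec (B (Suc k)) - Ec (B k)) \<le> cmod (Ec (\<lambda>x. Z k x * P x))
        + cmod (Ec (\<lambda>x. Z k x * of_real (Q x)))
        + cmod (of_real (t\<^sup>2 / 2) * Ec (\<lambda>x. Z k x * of_real (v k x - r k x)))"
      unfolding eq by (rule order_trans[OF norm_triangle_ineq4] add_right_mono norm_triangle_ineq4)+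
    moreover have "cmod (of_real (t\<^sup>2 / 2) * Ec (\<lambda>x. Z k x * of_real (v k x - r k x)))
        \<le> t\<^sup>2 / 2 * E (\<lambda>x. v k x - r k x)"
      unfolding norm_mult norm_of_real using 3 by (simp add: mult_left_mono)
    ultimately show ?thesis using 1 2 by linarith
  qed

  have first: "Ec (B 0) = of_real (exp (- (t\<^sup>2) / 2))"
  proof -
    have "B 0 = (\<lambda>_. of_real (exp (- (t\<^sup>2) / 2)))"
      by (simp add: fun_eq_iff B_def S_def R_def V_def)
    then show ?thesis by (simp add: Ec_def)
  qed
  have last: "cmod (Ec (\<lambda>x. iexp (t * S n x)) - Ec (B n)) \<le> t\<^sup>2 / 2 * E (R n)"
  proof -
    have "cmod (Ec (\<lambda>x. iexp (t * S n x)) - Ec (B n)) = cmod (Ec (\<lambda>x. iexp (t * S n x) - B n x))"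
      by (simp add: Ec_diff)
    also have "\<dots> \<le> E (\<lambda>x. t\<^sup>2 / 2 * R n x)"
    proof (rule Ec_norm)
      fix x
      have "iexp (t * S n x) - B n x = iexp (t * S n x) * of_real (1 - exp (- t\<^sup>2 * R n x / 2))"
        by (simp add: B_def algebra_simps)
      then have "cmod (iexp (t * S n x) - B n x) = \<bar>1 - exp (- t\<^sup>2 * R n x / 2)\<bar>"
        by (simp only: norm_mult norm_of_real norm_exp_i_times) simp
      also have "\<dots> = 1 - exp (- t\<^sup>2 * R n x / 2)" by (simp add: R_nonneg)
      also have "\<dots> \<le> t\<^sup>2 / 2 * R n x"
        using exp_ge_add_one_self[of "- t\<^sup>2 * R n x / 2"] by simp
      finally show "cmod (iexp (t * S n x) - B n x) \<le> t\<^sup>2 / 2 * R n x" .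
    qed
    finally show ?thesis unfolding E_cmult .
  qed
  have "Ec (B n) - Ec (B 0) = (\<Sum>k<n. Ec (B (Suc k)) - Ec (B k))"
    by (rule sum_lessThan_telescope[symmetric])
  then have "cmod (Ec (B n) - Ec (B 0)) \<le> (\<Sum>k<n. cmod (Ec (B (Suc k)) - Ec (B k)))"
    by (simp add: norm_sum)
  also have "\<dots> \<le> (\<Sum>k<n. \<bar>t\<bar>^3 / 12 * (e * E (v k) + E (\<lambda>x. (D k x)^4) / e)
        + t^4 / 8 * E (\<lambda>x. (D k x)^4) + t\<^sup>2 / 2 * E (\<lambda>x. v k x - r k x))"
    by (rule sum_mono) (rule step, simp)
  also have "\<dots> = \<bar>t\<bar>^3 / 12 * (e * E (V n) + L4 / e) + t^4 / 8 * L4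
        + t\<^sup>2 / 2 * E (\<lambda>x. \<Sum>k<n. v k x - r k x)"
  proof -
    have "E (V n) = (\<Sum>k<n. E (v k))" unfolding V_def by (rule E_sum)
    then show ?thesis
      unfolding E_sum by (simp add: sum.distrib sum_distrib_left sum_divide_distrib L4_def E_def[symmetric] distrib_left)
  qed
  \<comment> \<open>The overshoot of the budget and the shortfall R n combine to the distance of V n from 1.\<close>
  also have "(\<lambda>x. \<Sum>k<n. v k x - r k x) = (\<lambda>x. \<bar>V n x - 1\<bar> - R n x)"
  proof
    fix x
    have "(\<Sum>k<n. r k x) = R 0 x - R n x"
      unfolding r_def by (rule sum_lessThan_telescope')
    moreover have "R 0 x = 1" "R n x = max 0 (1 - V n x)" by (simp_all add: R_def V_def)
    moreover have "(\<Sum>k<n. v k x - r k x) = V n x - (\<Sum>k<n. r k x)"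
      by (simp add: sum_subtractf V_def)
    ultimately show "(\<Sum>k<n. v k x - r k x) = \<bar>V n x - 1\<bar> - R n x"
      by linarith
  qed
  finally have mid: "cmod (Ec (B n) - Ec (B 0)) \<le> \<bar>t\<bar>^3 / 12 * (e * E (V n) + L4 / e) + t^4 / 8 * L4
        + t\<^sup>2 / 2 * (E (\<lambda>x. \<bar>V n x - 1\<bar>) - E (R n))"
    unfolding E_diff .
  have "cmod (Ec (\<lambda>x. iexp (t * S n x)) - Ec (B 0))
      \<le> cmod (Ec (\<lambda>x. iexp (t * S n x)) - Ec (B n)) + cmod (Ec (B n) - Ec (B 0))"
    using norm_triangle_ineq[of "Ec (\<lambda>x. iexp (t * S n x)) - Ec (B n)" "Ec (B n) - Ec (B 0)"] by simp
  also note add_mono[OF last mid]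
  also have "t\<^sup>2 / 2 * E (R n) + (\<bar>t\<bar>^3 / 12 * (e * E (V n) + L4 / e) + t^4 / 8 * L4
        + t\<^sup>2 / 2 * (E (\<lambda>x. \<bar>V n x - 1\<bar>) - E (R n)))
      = t\<^sup>2 / 2 * E (\<lambda>x. \<bar>V n x - 1\<bar>) + \<bar>t\<bar>^3 / 12 * (e * E (V n) + L4 / e) + t^4 / 8 * L4"
    by (simp add: right_diff_distrib)
  finally show ?thesis
    unfolding first unfolding S_def V_def[abs_def] E_def Ec_def .
qed

section \<open>Agreement of independent uniform colours\<close>

definition iid_colours :: "'v set \<Rightarrow> 'a set \<Rightarrow> ('v \<Rightarrow> 'a) pmf" where
  "iid_colours I C = Pi_pmf I undefined (\<lambda>_. pmf_of_set C)"

definition agreement_excess :: "'a set \<Rightarrow> 'v \<Rightarrow> 'v \<Rightarrow> ('v \<Rightarrow> 'a) \<Rightarrow> real" where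
  "agreement_excess C j k Y = of_bool (Y j = Y k) - 1 / real (card C)"

lemma finite_iid_colours:
  assumes "finite I" "finite C" "C \<noteq> {}"
  shows "finite (set_pmf (iid_colours I C))"
  using assms by (simp add: iid_colours_def set_Pi_pmf finite_PiE_dflt)

lemma iid_colours_in:
  assumes "finite I" "finite C" "C \<noteq> {}" "Y \<in> set_pmf (iid_colours I C)" "i \<in> I"
  shows "Y i \<in> C"
  using assms by (simp add: iid_colours_def set_Pi_pmf PiE_dflt_def)

text \<open>
  Recolouring one vertex uniformly, independently of everything else, does not change the law of
  the colouring. All conditional expectations given the other colours are computed this way.
\<close>

lemma expectation_resample:
  fixes f :: "('v \<Rightarrow> 'a) \<Rightarrow> 'b::{banach, second_countable_topology}"
  assumes I: "finite I" "i \<in> I" and C: "finite C" "C \<noteq> {}"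
  shows "measure_pmf.expectation (iid_colours I C) f =
    measure_pmf.expectation (iid_colours I C) (\<lambda>Y. (\<Sum>a\<in>C. f (Y(i := a))) /\<^sub>R real (card C))"
proof -
  define P where "P = iid_colours (I - {i}) C"
  have finP: "finite (set_pmf P)" unfolding P_def using I C by (intro finite_iid_colours) auto
  have "iid_colours I C = Pi_pmf (insert i (I - {i})) undefined (\<lambda>_. pmf_of_set C)"
    using I by (simp add: iid_colours_def insert_absorb)
  also have "\<dots> = pmf_of_set C \<bind> (\<lambda>y. P \<bind> (\<lambda>g. return_pmf (g(i := y))))"
    using I by (subst Pi_pmf_insert') (simp_all add: P_def iid_colours_def)
  also have "\<dots> = P \<bind> (\<lambda>g. map_pmf (\<lambda>y. g(i := y)) (pmf_of_set C))"
    by (subst bind_commute_pmf) (simp add: map_pmf_def)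
  finally have eq: "iid_colours I C = \<dots>" .
  have avg: "measure_pmf.expectation (iid_colours I C) F =
      (\<Sum>g\<in>set_pmf P. pmf P g *\<^sub>R ((\<Sum>a\<in>C. F (g(i := a))) /\<^sub>R real (card C)))"
    for F :: "('v \<Rightarrow> 'a) \<Rightarrow> 'b"
  proof -
    have "measure_pmf.expectation (pmf_of_set C) G = (\<Sum>a\<in>C. G a) /\<^sub>R real (card C)"
      for G :: "'a \<Rightarrow> 'b"
      using C by (subst integral_measure_pmf[of C]) (simp_all add: scaleR_sum_right divide_inverse)
    then show ?thesis
      unfolding eq using C finP by (subst pmf_expectation_bind[where A = "set_pmf P"]) simp_all
  qed
  show ?thesis
    unfolding avg using C by (simp add: sum_constant_scaleR)
qed

text \<open>
  \<open>w\<close> is the conditional expectation of \<open>f\<close> given all colours but that of \<open>i\<close>, and \<open>g\<close> is a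
  test function of those colours.
\<close>

lemma expectation_resample_factor:
  fixes g :: "('v \<Rightarrow> 'a) \<Rightarrow> 'b::{real_normed_field, banach, second_countable_topology}"
  assumes I: "finite I" "i \<in> I" and C: "finite C" "C \<noteq> {}"
    and g: "\<And>Y a. g (Y(i := a)) = g Y"
    and w: "\<And>Y. Y \<in> set_pmf (iid_colours I C) \<Longrightarrow> (\<Sum>a\<in>C. f (Y(i := a))) = real (card C) * w Y"
  shows "measure_pmf.expectation (iid_colours I C) (\<lambda>Y. g Y * of_real (f Y)) =
    measure_pmf.expectation (iid_colours I C) (\<lambda>Y. g Y * of_real (w Y))"
proof (subst expectation_resample[OF I C], rule integral_cong_AE)
  show "AE Y in measure_pmf (iid_colours I C).
    (\<Sum>a\<in>C. g (Y(i := a)) * of_real (f (Y(i := a)))) /\<^sub>R real (card C) = g Y * of_real (w Y)"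
  proof (rule AE_pmfI)
    fix Y assume Y: "Y \<in> set_pmf (iid_colours I C)"
    have "(\<Sum>a\<in>C. g (Y(i := a)) * of_real (f (Y(i := a)))) = g Y * of_real (\<Sum>a\<in>C. f (Y(i := a)))"
      by (simp add: g sum_distrib_left)
    also have "\<dots> /\<^sub>R real (card C) = g Y * of_real (w Y)"
      unfolding w[OF Y] using C by (simp add: scaleR_conv_of_real field_simps)
    finally show "(\<Sum>a\<in>C. g (Y(i := a)) * of_real (f (Y(i := a)))) /\<^sub>R real (card C) = g Y * of_real (w Y)" .
  qed
qed simp_all

lemma sum_colour_excess:
  assumes "finite C" "x \<in> C"
  shows "(\<Sum>a\<in>C. of_bool (x = a) - 1 / real (card C)) = 0"
proof -
  have "C \<noteq> {}" using assms by auto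
  then show ?thesis using assms by (simp add: sum_subtractf of_bool_def)
qed

lemma sum_colour_excess_mult:
  assumes C: "finite C" and "x \<in> C" "y \<in> C"
  shows "(\<Sum>a\<in>C. (of_bool (x = a) - 1 / real (card C)) * (of_bool (y = a) - 1 / real (card C)))
    = of_bool (x = y) - 1 / real (card C)"
proof -
  define q where "q = 1 / real (card C)"
  have "(\<Sum>a\<in>C. (of_bool (x = a) - q) * (of_bool (y = a) - q))
    = (\<Sum>a\<in>C. (if x = a then of_bool (y = a) - q else 0) - q * (of_bool (y = a) - q))"
    by (intro sum.cong) (auto simp: left_diff_distrib)
  also have "\<dots> = (\<Sum>a\<in>C. if x = a then of_bool (y = a) - q else 0) - q * (\<Sum>a\<in>C. of_bool (y = a) - q)"
    by (subst sum_subtractf) (rule arg_cong2[OF refl], rule sum_distrib_left[symmetric])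
  also have "(\<Sum>a\<in>C. if x = a then of_bool (y = a) - q else 0) = of_bool (y = x) - q"
    using assms by (subst sum.delta') auto
  also have "(\<Sum>a\<in>C. of_bool (y = a) - q) = 0"
    unfolding q_def by (rule sum_colour_excess[OF C \<open>y \<in> C\<close>])
  finally show ?thesis by (auto simp: q_def)
qed

lemma sum_power_excess:
  fixes q :: real
  assumes "finite C" "x \<in> C"
  shows "(\<Sum>a\<in>C. (of_bool (x = a) - q)^b) = (1 - q)^b + real (card C - 1) * (- q)^b"
proof -
  have "(\<Sum>a\<in>C. (of_bool (x = a) - q)^b) = (1 - q)^b + (\<Sum>a\<in>C - {x}. (of_bool (x = a) - q)^b)"
    using assms by (simp add: sum.remove)
  also have "(\<Sum>a\<in>C - {x}. (of_bool (x = a) - q)^b) = (\<Sum>a\<in>C - {x}. (- q)^b)"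
    by (intro sum.cong) auto
  finally show ?thesis using assms by simp
qed

lemma agreement_excess_commute: "agreement_excess C j k = agreement_excess C k j"
  by (simp add: agreement_excess_def fun_eq_iff eq_commute)

lemma abs_agreement_excess_le_1:
  assumes "finite C" "C \<noteq> {}"
  shows "\<bar>agreement_excess C j k Y\<bar> \<le> 1"
proof -
  have "1 \<le> real (card C)" using assms by (simp add: Suc_le_eq card_gt_0_iff)
  then have "0 \<le> 1 / real (card C)" "1 / real (card C) \<le> 1" by simp_all
  moreover have "0 \<le> (of_bool (Y j = Y k) :: real)" "(of_bool (Y j = Y k) :: real) \<le> 1" by simp_all
  ultimately show ?thesis unfolding agreement_excess_def by linarith
qed

text \<open>
  Given all colours but that of \<open>j\<close>, the excess is \<open>1 - 1/c\<close> for one colour of \<open>j\<close> and \<open>-1/c\<close>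
  for the \<open>c - 1\<close> others, whatever the colour of \<open>k\<close> is. So it is independent of the other colours,
  including that of \<open>k\<close>, which is why its conditional moments factor out as constants.
\<close>

lemma excess_conditional_moment:
  fixes g :: "('v \<Rightarrow> 'a) \<Rightarrow> real" and b :: nat
  assumes I: "finite I" "j \<in> I" "k \<in> I" "j \<noteq> k" and C: "finite C" "C \<noteq> {}"
    and g: "\<And>Y a. g (Y(j := a)) = g Y"
  defines "q \<equiv> 1 / real (card C)"
  shows "measure_pmf.expectation (iid_colours I C) (\<lambda>Y. g Y * agreement_excess C j k Y ^ b) =
    q * ((1 - q)^b + real (card C - 1) * (- q)^b) * measure_pmf.expectation (iid_colours I C) g"
proof -
  have "measure_pmf.expectation (iid_colours I C) (\<lambda>Y. g Y * of_real (agreement_excess C j k Y ^ b)) =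
    measure_pmf.expectation (iid_colours I C) (\<lambda>Y. g Y * of_real (q * ((1 - q)^b + real (card C - 1) * (- q)^b)))"
  proof (rule expectation_resample_factor[OF I(1,2) C])
    fix Y assume "Y \<in> set_pmf (iid_colours I C)"
    then have "Y k \<in> C" using iid_colours_in[OF I(1) C] I by blast
    moreover have "agreement_excess C j k (Y(j := a)) = of_bool (Y k = a) - q" for a
      using I by (auto simp: agreement_excess_def q_def)
    ultimately
    show "(\<Sum>a\<in>C. agreement_excess C j k (Y(j := a)) ^ b) =
        real (card C) * (q * ((1 - q)^b + real (card C - 1) * (- q)^b))"
      using C sum_power_excess[OF C(1), of "Y k" q b] by (simp add: q_def)
  qed (rule g)
  then show ?thesis by simp
qed

lemma
  fixes g :: "('v \<Rightarrow> 'a) \<Rightarrow> real"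
  assumes I: "finite I" "j \<in> I" "k \<in> I" "j \<noteq> k" and C: "finite C" "C \<noteq> {}"
    and g: "\<And>Y a. g (Y(j := a)) = g Y"
  shows excess_uncorrelated:
      "measure_pmf.expectation (iid_colours I C) (\<lambda>Y. g Y * agreement_excess C j k Y) = 0"
    and excess_square:
      "measure_pmf.expectation (iid_colours I C) (\<lambda>Y. g Y * (agreement_excess C j k Y)\<^sup>2) =
       1 / real (card C) * (1 - 1 / real (card C)) * measure_pmf.expectation (iid_colours I C) g"
proof -
  define c where "c = real (card C)"
  have "card C \<ge> 1" using C by (simp add: Suc_le_eq card_gt_0_iff)
  then have c: "c > 0" "real (card C - 1) = c - 1" by (auto simp: c_def of_nat_diff)
  have "(1 - 1 / c)^1 + (c - 1) * (- (1 / c))^1 = 0"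
    using c(1) by (simp add: field_simps)
  then show "measure_pmf.expectation (iid_colours I C) (\<lambda>Y. g Y * agreement_excess C j k Y) = 0"
    using excess_conditional_moment[where b = 1 and g = g, OF I C g] unfolding c(2) c_def by simp
  have "(1 - 1 / c)\<^sup>2 + (c - 1) * (- (1 / c))\<^sup>2 = 1 - 1 / c"
    using c(1) by (simp add: field_simps power2_eq_square)
  then show "measure_pmf.expectation (iid_colours I C) (\<lambda>Y. g Y * (agreement_excess C j k Y)\<^sup>2) =
       1 / real (card C) * (1 - 1 / real (card C)) * measure_pmf.expectation (iid_colours I C) g"
    using excess_conditional_moment[where b = 2 and g = g, OF I C g] unfolding c(2) c_def by simp
qed

text \<open>
  For fixed \<open>k\<close> the summands are independent and centred, so adding a neighbour \<open>j\<close> to \<open>B\<close> raises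
  the fourth moment by \<open>6 E S\<^sup>2 \<mu>\<close> and the fourth moment of one summand, which is at
  most \<open>\<mu>\<close> because a summand has absolute value at most \<open>1\<close>; the odd terms vanish.
  The three moments are needed together in the induction.
\<close>

lemma excess_sum_moments:
  assumes I: "finite I" "k \<in> I" and C: "finite C" "C \<noteq> {}"
    and B: "finite B" "B \<subseteq> I - {k}"
  defines "S \<equiv> \<lambda>B Y. \<Sum>j\<in>B. agreement_excess C j k Y"
    and "\<mu> \<equiv> 1 / real (card C) * (1 - 1 / real (card C))"
  shows "measure_pmf.expectation (iid_colours I C) (S B) = 0 \<and>
    measure_pmf.expectation (iid_colours I C) (\<lambda>Y. (S B Y)\<^sup>2) = real (card B) * \<mu> \<and>
    measure_pmf.expectation (iid_colours I C) (\<lambda>Y. (S B Y)^4) \<le> 3 * (real (card B) * \<mu>)\<^sup>2 + real (card B) * \<mu>"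
  using B
proof (induction B rule: finite_induct)
  case empty
  then show ?case by (simp add: S_def)
next
  case (insert j B)
  define E where "E f = measure_pmf.expectation (iid_colours I C) f" for f :: "('a \<Rightarrow> 'b) \<Rightarrow> real"
  have int[simp]: "integrable (measure_pmf (iid_colours I C)) f" for f :: "('a \<Rightarrow> 'b) \<Rightarrow> real"
    by (intro integrable_measure_pmf_finite finite_iid_colours I C)
  have E_add: "E (\<lambda>x. f x + g x) = E f + E g" for f g by (simp add: E_def)
  have E_cmult: "E (\<lambda>x. a * f x) = a * E f" for a f by (simp add: E_def)
  have E_mono: "E f \<le> E g" if "\<And>x. f x \<le> g x" for f g
    unfolding E_def by (rule integral_mono) (use that in auto)
  have IH: "E (S B) = 0" "E (\<lambda>Y. (S B Y)\<^sup>2) = real (card B) * \<mu>"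
    "E (\<lambda>Y. (S B Y)^4) \<le> 3 * (real (card B) * \<mu>)\<^sup>2 + real (card B) * \<mu>"
    using insert by (auto simp: E_def)
  define X where "X = agreement_excess C j k"
  have jk: "j \<in> I" "j \<noteq> k" using insert by auto
  have S_indep: "S B (Y(j := a)) = S B Y" for Y a
    unfolding S_def by (intro sum.cong refl) (use insert jk in \<open>auto simp: agreement_excess_def\<close>)
  have S_insert: "S (insert j B) Y = S B Y + X Y" for Y
    using insert by (simp add: S_def X_def)
  note uncor = excess_uncorrelated[OF I(1) jk(1) I(2) jk(2) C, folded E_def X_def]
  note sq = excess_square[OF I(1) jk(1) I(2) jk(2) C, folded E_def X_def \<mu>_def]
  have X1: "E X = 0" using uncor[of "\<lambda>_. 1"] by simp
  have X2: "E (\<lambda>Y. (X Y)\<^sup>2) = \<mu>" using sq[of "\<lambda>_. 1"] by (simp add: E_def)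
  have X4: "E (\<lambda>Y. (X Y)^4) \<le> \<mu>"
    unfolding X2[symmetric]
  proof (rule E_mono)
    fix Y
    have "(X Y)\<^sup>2 \<le> 1" using abs_agreement_excess_le_1[OF C] unfolding X_def abs_square_le_1 .
    then show "(X Y)^4 \<le> (X Y)\<^sup>2"
      using mult_left_mono[of "(X Y)\<^sup>2" 1 "(X Y)\<^sup>2"] by (simp add: power2_eq_square power4_eq_xxxx mult.assoc)
  qed
  have "E (S (insert j B)) = 0"
    unfolding S_insert[abs_def] using E_add IH X1 by simp
  moreover have E2: "E (\<lambda>Y. (S (insert j B) Y)\<^sup>2) = real (card (insert j B)) * \<mu>"
  proof -
    have "(S (insert j B) Y)\<^sup>2 = (S B Y)\<^sup>2 + (2 * (S B Y * X Y) + (X Y)\<^sup>2)" for Y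
      unfolding S_insert by (simp add: power2_eq_square algebra_simps)
    then have "E (\<lambda>Y. (S (insert j B) Y)\<^sup>2) = E (\<lambda>Y. (S B Y)\<^sup>2) + (2 * E (\<lambda>Y. S B Y * X Y) + E (\<lambda>Y. (X Y)\<^sup>2))"
      by (simp only: E_add E_cmult)
    then show ?thesis using insert uncor[of "S B", OF S_indep] by (simp add: IH X2 algebra_simps)
  qed
  moreover have "E (\<lambda>Y. (S (insert j B) Y)^4) \<le>
     3 * (real (card (insert j B)) * \<mu>)\<^sup>2 + real (card (insert j B)) * \<mu>"
  proof -
    have "(S (insert j B) Y)^4 = (S B Y)^4 + (4 * ((S B Y)^3 * X Y) + (6 * ((S B Y)\<^sup>2 * (X Y)\<^sup>2)
        + (4 * (S B Y * (X Y)^3) + (X Y)^4)))" for Y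
      unfolding S_insert by (simp add: eval_nat_numeral algebra_simps)
    then have "E (\<lambda>Y. (S (insert j B) Y)^4) = E (\<lambda>Y. (S B Y)^4) + (4 * E (\<lambda>Y. (S B Y)^3 * X Y)
        + (6 * E (\<lambda>Y. (S B Y)\<^sup>2 * (X Y)\<^sup>2) + (4 * E (\<lambda>Y. S B Y * (X Y)^3) + E (\<lambda>Y. (X Y)^4))))"
      by (simp only: E_add E_cmult)
    moreover have "E (\<lambda>Y. (S B Y)^3 * X Y) = 0"
      by (rule uncor) (simp add: S_indep)
    moreover have "E (\<lambda>Y. (S B Y)\<^sup>2 * (X Y)\<^sup>2) = \<mu> * (real (card B) * \<mu>)"
      by (subst sq) (simp_all add: S_indep IH)
    moreover have "E (\<lambda>Y. S B Y * (X Y)^3) = 0"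
      using excess_conditional_moment[where b = 3, OF I(1) jk(1) I(2) jk(2) C, of "S B", OF S_indep] IH
      by (simp add: E_def X_def)
    ultimately have "E (\<lambda>Y. (S (insert j B) Y)^4) \<le>
        3 * (real (card B) * \<mu>)\<^sup>2 + real (card B) * \<mu> + 6 * (\<mu> * (real (card B) * \<mu>)) + \<mu>"
      using IH X4 by simp
    also have "\<dots> \<le> 3 * (real (Suc (card B)) * \<mu>)\<^sup>2 + real (Suc (card B)) * \<mu>"
      by (simp add: power2_eq_square algebra_simps)
    finally show ?thesis using insert by simp
  qed
  ultimately show ?case by (simp add: E_def)
qed

text \<open>
  The covariances vanish: two different pairs \<open>j < k\<close> and \<open>j' < k'\<close> are such that the second
  contains a vertex outside the first, and recolouring that vertex averages the second excess to
  \<open>0\<close> while the first stays unchanged.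
\<close>

lemma weighted_excess_variance:
  fixes w :: "nat \<Rightarrow> nat \<Rightarrow> real" and n :: nat
  assumes C: "finite C" "C \<noteq> {}"
  defines "\<mu> \<equiv> 1 / real (card C) * (1 - 1 / real (card C))"
  shows "measure_pmf.expectation (iid_colours {..<n} C)
     (\<lambda>Y. (\<Sum>k<n. \<Sum>j<k. w j k * agreement_excess C j k Y)\<^sup>2) = \<mu> * (\<Sum>k<n. \<Sum>j<k. (w j k)\<^sup>2)"
proof -
  define P where "P = Sigma {..<n} (\<lambda>k. {..<k})"
  have finP: "finite P" by (simp add: P_def)
  define X where "X p = agreement_excess C (snd p) (fst p)" for p :: "nat \<times> nat"
  define u where "u p = w (snd p) (fst p)" for p :: "nat \<times> nat"
  define E where "E f = measure_pmf.expectation (iid_colours {..<n} C) f" for f :: "(nat \<Rightarrow> 'a) \<Rightarrow> real"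
  have int[simp]: "integrable (measure_pmf (iid_colours {..<n} C)) f" for f :: "(nat \<Rightarrow> 'a) \<Rightarrow> real"
    by (intro integrable_measure_pmf_finite finite_iid_colours C) simp
  have cov: "E (\<lambda>Y. X p Y * X p' Y) = (if p = p' then \<mu> else 0)" if pP: "p \<in> P" "p' \<in> P" for p p'
  proof -
    obtain k j k' j' where p: "p = (k, j)" "p' = (k', j')" by (cases p, cases p')
    have lt: "j < k" "k < n" "j' < k'" "k' < n" using pP p by (auto simp: P_def)
    have indep: "agreement_excess C j k (Y(i := a)) = agreement_excess C j k Y" if "i \<noteq> j" "i \<noteq> k" for Y i a
      using that by (simp add: agreement_excess_def)
    consider "p = p'" | "k' \<noteq> j" "k' \<noteq> k" | "j' \<noteq> j" "j' \<noteq> k"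
      using p lt by (cases "k' = k"; cases "k' = j") auto
    then show ?thesis
    proof cases
      case 1
      have "E (\<lambda>Y. 1 * (agreement_excess C j k Y)\<^sup>2) = \<mu> * E (\<lambda>_. 1)"
        unfolding E_def \<mu>_def by (rule excess_square) (use lt C in auto)
      then show ?thesis using 1 p by (simp add: X_def E_def power2_eq_square)
    next
      case 2
      have "E (\<lambda>Y. agreement_excess C j k Y * agreement_excess C k' j' Y) = 0"
        unfolding E_def by (rule excess_uncorrelated) (use lt C indep[OF 2] in auto)
      then show ?thesis using 2 p by (auto simp: X_def agreement_excess_commute[of C k'])
    next
      case 3
      have "E (\<lambda>Y. agreement_excess C j k Y * agreement_excess C j' k' Y) = 0"
        unfolding E_def by (rule excess_uncorrelated) (use lt C indep[OF 3] in auto)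
      then show ?thesis using 3 p by (auto simp: X_def)
    qed
  qed
  have "E (\<lambda>Y. (\<Sum>p\<in>P. u p * X p Y)\<^sup>2) = E (\<lambda>Y. \<Sum>p\<in>P. \<Sum>p'\<in>P. (u p * u p') * (X p Y * X p' Y))"
    unfolding power2_eq_square sum_product by (simp add: mult_ac)
  also have "\<dots> = (\<Sum>p\<in>P. \<Sum>p'\<in>P. (u p * u p') * E (\<lambda>Y. X p Y * X p' Y))"
    by (simp add: E_def)
  also have "\<dots> = (\<Sum>p\<in>P. \<Sum>p'\<in>P. if p = p' then u p * u p' * \<mu> else 0)"
    by (intro sum.cong refl) (simp add: cov)
  also have "\<dots> = \<mu> * (\<Sum>p\<in>P. (u p)\<^sup>2)"
    using finP by (simp add: sum_distrib_left power2_eq_square mult_ac)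
  finally show ?thesis
    unfolding P_def E_def by (simp add: sum.Sigma u_def X_def case_prod_beta)
qed

section \<open>Revealing the colours one vertex at a time\<close>

text \<open>
  The vertices are now \<open>0, \<dots>, n - 1\<close> in the order of revelation, and \<open>B k\<close> is the set of the
  neighbours of \<open>k\<close> that precede it.
\<close>

lemma symmetric_double_sum:
  fixes f :: "nat \<Rightarrow> nat \<Rightarrow> real"
  assumes "\<And>j l. f j l = f l j"
  shows "(\<Sum>j<n. \<Sum>l<n. f j l) = (\<Sum>j<n. f j j) + 2 * (\<Sum>l<n. \<Sum>j<l. f j l)"
proof (induction n)
  case (Suc n)
  have "(\<Sum>j<n. f j n) = (\<Sum>j<n. f n j)" using assms by (intro sum.cong) auto
  then show ?case using Suc by (simp add: sum.distrib)
qed simp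

text \<open>
  The number of common later neighbours of \<open>j\<close> and \<open>l\<close>, as a sum of products so that sums over
  pairs can be interchanged. On the diagonal it is the number of later neighbours of \<open>j\<close>.
\<close>

definition codegree :: "(nat \<Rightarrow> nat set) \<Rightarrow> nat \<Rightarrow> nat \<Rightarrow> nat \<Rightarrow> real" where
  "codegree B n j l = (\<Sum>k<n. of_bool (j \<in> B k) * of_bool (l \<in> B k))"

lemma codegree_commute: "codegree B n j l = codegree B n l j"
  by (simp add: codegree_def mult.commute)

lemma sum_codegree_diagonal:
  assumes "\<And>k. k < n \<Longrightarrow> B k \<subseteq> {..<k}"
  shows "(\<Sum>j<n. codegree B n j j) = real (\<Sum>k<n. card (B k))"
proof -
  have "(\<Sum>j<n. codegree B n j j) = (\<Sum>k<n. \<Sum>j<n. of_bool (j \<in> B k))"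
    unfolding codegree_def by (subst sum.swap) (intro sum.cong refl, simp add: of_bool_def)
  also have "\<dots> = (\<Sum>k<n. real (card (B k)))"
  proof (intro sum.cong refl)
    fix k assume "k \<in> {..<n}"
    then have "{..<n} \<inter> {j. j \<in> B k} = B k" using assms[of k] by auto
    then show "(\<Sum>j<n. of_bool (j \<in> B k)) = real (card (B k))" by simp
  qed
  finally show ?thesis by simp
qed

text \<open>
  Common later neighbours of \<open>j\<close> and \<open>l\<close> are later neighbours of each, so the square of the
  codegree is at most the product of the two diagonal entries; these add up to the number of edges.
\<close>

lemma sum_codegree_squares_le:
  assumes B: "\<And>k. k < n \<Longrightarrow> B k \<subseteq> {..<k}"
  shows "(\<Sum>l<n. \<Sum>j<l. (codegree B n j l)\<^sup>2) \<le> (real (\<Sum>k<n. card (B k)))\<^sup>2"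
proof -
  have nonneg: "0 \<le> codegree B n j l" for j l unfolding codegree_def by (intro sum_nonneg) simp
  have le1: "codegree B n j l \<le> codegree B n j j" for j l
    unfolding codegree_def by (intro sum_mono) simp
  have le: "(codegree B n j l)\<^sup>2 \<le> codegree B n l l * codegree B n j j" for j l
    unfolding power2_eq_square
    using le1[of l j] le1[of j l] nonneg codegree_commute[of B n j l] by (intro mult_mono) auto
  have "(\<Sum>l<n. \<Sum>j<l. (codegree B n j l)\<^sup>2) \<le> (\<Sum>l<n. \<Sum>j<n. (codegree B n j l)\<^sup>2)"
    by (intro sum_mono sum_mono2) auto
  also have "\<dots> \<le> (\<Sum>l<n. \<Sum>j<n. codegree B n l l * codegree B n j j)"
    by (intro sum_mono le)
  also have "\<dots> = (\<Sum>l<n. codegree B n l l) * (\<Sum>j<n. codegree B n j j)"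
    by (rule sum_product[symmetric])
  also have "(\<Sum>j<n. codegree B n j j) = real (\<Sum>k<n. card (B k))"
    by (rule sum_codegree_diagonal) (rule B)
  finally show ?thesis by (simp only: power2_eq_square)
qed

lemma sum_back_pairs:
  fixes f :: "nat \<Rightarrow> nat \<Rightarrow> real"
  assumes B: "\<And>k. k < n \<Longrightarrow> B k \<subseteq> {..<k}" and sym: "\<And>j l. f j l = f l j"
  shows "(\<Sum>k<n. \<Sum>j\<in>B k. \<Sum>l\<in>B k. f j l) =
    (\<Sum>j<n. codegree B n j j * f j j) + 2 * (\<Sum>l<n. \<Sum>j<l. codegree B n j l * f j l)"
proof -
  have "(\<Sum>k<n. \<Sum>j\<in>B k. \<Sum>l\<in>B k. f j l)
     = (\<Sum>k<n. \<Sum>j<n. \<Sum>l<n. of_bool (j \<in> B k) * of_bool (l \<in> B k) * f j l)"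
  proof (rule sum.cong[OF refl])
    fix k assume "k \<in> {..<n}"
    then have sub: "B k \<subseteq> {..<n}" using B[of k] by auto
    have inner: "(\<Sum>l\<in>B k. g l) = (\<Sum>l<n. of_bool (l \<in> B k) * g l)" for g :: "nat \<Rightarrow> real"
      by (rule sum.mono_neutral_cong_left) (use sub in auto)
    show "(\<Sum>j\<in>B k. \<Sum>l\<in>B k. f j l) = (\<Sum>j<n. \<Sum>l<n. of_bool (j \<in> B k) * of_bool (l \<in> B k) * f j l)"
      unfolding inner sum_distrib_left mult.assoc ..
  qed
  also have "\<dots> = (\<Sum>j<n. \<Sum>k<n. \<Sum>l<n. of_bool (j \<in> B k) * of_bool (l \<in> B k) * f j l)"
    by (rule sum.swap)
  also have "\<dots> = (\<Sum>j<n. \<Sum>l<n. codegree B n j l * f j l)"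
    unfolding codegree_def sum_distrib_right by (intro sum.cong refl sum.swap)
  also have "\<dots> = (\<Sum>j<n. codegree B n j j * f j j) + 2 * (\<Sum>l<n. \<Sum>j<l. codegree B n j l * f j l)"
    by (rule symmetric_double_sum) (metis codegree_commute sym)
  finally show ?thesis .
qed

text \<open>
  The hypothesis \<open>deg\<close> is what a good order of revelation provides. It enters only through the fourth
  moments, where it bounds \<open>\<Sum>k<n. (card (B k))\<^sup>2\<close> by \<open>sqrt (2 * m) * m\<close>.
\<close>

lemma back_neighbour_char_bound:
  fixes C :: "'a set" and B :: "nat \<Rightarrow> nat set" and n :: nat and t :: real
  assumes C: "finite C" "C \<noteq> {}" and B: "\<And>k. k < n \<Longrightarrow> B k \<subseteq> {..<k}"
  defines "m \<equiv> (\<Sum>k<n. card (B k))" and "c \<equiv> real (card C)"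
  defines "\<sigma> \<equiv> sqrt (real m / c)"
  defines "\<delta> \<equiv> 5 / \<sigma> + 1 / \<sigma>\<^sup>2"
  assumes m: "m > 0" and deg: "\<And>k. k < n \<Longrightarrow> (card (B k))\<^sup>2 \<le> 2 * m"
  shows "cmod (measure_pmf.expectation (iid_colours {..<n} C)
      (\<lambda>Y. iexp (t * ((\<Sum>k<n. \<Sum>j\<in>B k. agreement_excess C j k Y) / \<sigma>))) - exp (- (t\<^sup>2) / 2))
    \<le> 3 * t\<^sup>2 / (2 * sqrt c) + \<bar>t\<bar>^3 * sqrt \<delta> / 6 + t^4 * \<delta> / 8"
proof -
  define M where "M = iid_colours {..<n} C"
  define E where "E f = measure_pmf.expectation M f" for f :: "(nat \<Rightarrow> 'a) \<Rightarrow> real"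
  define \<mu> where "\<mu> = 1 / c * (1 - 1 / c)"
  define S where "S k Y = (\<Sum>j\<in>B k. agreement_excess C j k Y)" for k Y
  define D where "D k Y = S k Y / \<sigma>" for k Y
  \<comment> \<open>The conditional variance of D k is written as an average over the colours of k, which makes it
    nonnegative everywhere; its formula in terms of pairs of earlier neighbours holds only for
    colourings with values in C.\<close>
  define v where "v k Y = (\<Sum>a\<in>C. (D k (Y(k := a)))\<^sup>2) / c" for k Y
  define h where "h k Y = restrict Y {..<k}" for k :: nat and Y :: "nat \<Rightarrow> 'a"
  have c: "c \<ge> 1" using C by (simp add: c_def Suc_le_eq card_gt_0_iff)
  have \<sigma>: "\<sigma> > 0" "\<sigma>\<^sup>2 = real m / c" using m c by (simp_all add: \<sigma>_def)
  have \<mu>: "0 \<le> \<mu>" "\<mu> \<le> 1 / c" using c by (simp_all add: \<mu>_def field_simps)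
  have \<delta>: "\<delta> > 0" unfolding \<delta>_def using \<sigma>(1) by (intro add_pos_pos divide_pos_pos zero_less_power) auto
  have finM: "finite (set_pmf M)" unfolding M_def by (intro finite_iid_colours C) simp
  have int[simp]: "integrable (measure_pmf M) f" for f :: "(nat \<Rightarrow> 'a) \<Rightarrow> real"
    by (rule integrable_measure_pmf_finite[OF finM])
  have E_add: "E (\<lambda>x. f x + g x) = E f + E g" for f g by (simp add: E_def)
  have E_cmult: "E (\<lambda>x. a * f x) = a * E f" for a f by (simp add: E_def)
  have E_sum: "E (\<lambda>x. \<Sum>k<n. f k x) = (\<Sum>k<n. E (f k))" for f by (simp add: E_def)
  have E_mono: "E f \<le> E g" if "\<And>x. x \<in> set_pmf M \<Longrightarrow> f x \<le> g x" for f g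
    unfolding E_def by (rule integral_mono_AE) (auto intro: AE_pmfI that)
  have h_eqD: "Y j = Y' j" if "h k Y = h k Y'" "j < k" for k Y Y' j
    using fun_cong[OF that(1), of j] that(2) by (simp add: h_def)
  have h_upd: "h k (Y(k := a)) = h k Y" for k Y a
    by (simp add: h_def restrict_def fun_eq_iff)
  have S_cong: "S k Y = S k Y'" if "k < n" "\<And>j. j \<le> k \<Longrightarrow> Y j = Y' j" for k Y Y'
    unfolding S_def agreement_excess_def
  proof (intro sum.cong refl)
    fix j assume "j \<in> B k"
    then have "j \<le> k" using B[OF that(1)] by auto
    from that(2)[OF this] that(2)[OF order_refl]
    show "of_bool (Y j = Y k) - 1 / real (card C) = of_bool (Y' j = Y' k) - 1 / real (card C)" by (simp only:)
  qed
  have S_upd: "S k (Y(k := a)) = (\<Sum>j\<in>B k. of_bool (Y j = a) - 1 / c)" if "k < n" for k Y a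
    unfolding S_def agreement_excess_def c_def
    by (intro sum.cong refl) (use B[OF that] in auto)
  have col: "Y j \<in> C" if "Y \<in> set_pmf M" "j < n" for Y j
    using iid_colours_in[OF _ C that(1)[unfolded M_def]] that(2) by simp

  have adapted: "determined_by (h k) (D j)" if "j < k" "k < n" for j k
    unfolding determined_by_def
  proof (intro allI impI)
    fix Y Y' assume "h k Y = h k Y'"
    then have "S j Y = S j Y'" using that h_eqD by (intro S_cong) auto
    then show "D j Y = D j Y'" by (simp only: D_def)
  qed
  have predictable: "determined_by (h k) (v j)" if "j \<le> k" "k < n" for j k
    unfolding determined_by_def
  proof (intro allI impI)
    fix Y Y' assume "h k Y = h k Y'"
    then have "S j (Y(j := a)) = S j (Y'(j := a))" for a using that h_eqD by (intro S_cong) auto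
    then show "v j Y = v j Y'" by (simp only: v_def D_def)
  qed
  have v_nonneg: "v k Y \<ge> 0" for k Y using c by (simp add: v_def sum_nonneg)
  have centred: "measure_pmf.expectation M (\<lambda>x. (g x :: complex) * of_real (D k x)) = 0"
    if "k < n" "determined_by (h k) g" for k g
  proof -
    have "measure_pmf.expectation M (\<lambda>x. g x * of_real (D k x)) = measure_pmf.expectation M (\<lambda>x. g x * of_real 0)"
      unfolding M_def
    proof (rule expectation_resample_factor)
      show "g (Y(k := a)) = g Y" for Y a using that(2) h_upd unfolding determined_by_def by blast
      fix Y assume "Y \<in> set_pmf (iid_colours {..<n} C)"
      then have Y: "Y \<in> set_pmf M" by (simp add: M_def)
      have "(\<Sum>a\<in>C. S k (Y(k := a))) = (\<Sum>j\<in>B k. \<Sum>a\<in>C. of_bool (Y j = a) - 1 / c)"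
        unfolding S_upd[OF that(1)] by (rule sum.swap)
      also have "\<dots> = 0"
      proof (rule sum.neutral, rule ballI)
        fix j assume "j \<in> B k"
        then have "Y j \<in> C" using B[OF that(1)] that(1) by (intro col[OF Y]) auto
        then show "(\<Sum>a\<in>C. of_bool (Y j = a) - 1 / c) = 0"
          unfolding c_def by (rule sum_colour_excess[OF C(1)])
      qed
      finally show "(\<Sum>a\<in>C. D k (Y(k := a))) = real (card C) * 0"
        unfolding D_def sum_divide_distrib[symmetric] by simp
    qed (use C that in auto)
    then show ?thesis by simp
  qed
  have variance: "measure_pmf.expectation M (\<lambda>x. g x * of_real ((D k x)\<^sup>2)) =
      measure_pmf.expectation M (\<lambda>x. g x * of_real (v k x))"
    if "k < n" "determined_by (h k) g" for k and g :: "_ \<Rightarrow> complex"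
    unfolding M_def
  proof (rule expectation_resample_factor)
    show "g (Y(k := a)) = g Y" for Y a using that(2) h_upd unfolding determined_by_def by blast
    show "(\<Sum>a\<in>C. (D k (Y(k := a)))\<^sup>2) = real (card C) * v k Y" for Y
      using c by (simp add: v_def c_def)
  qed (use C that in auto)

  have moments: "E (\<lambda>Y. (S k Y)\<^sup>2) = real (card (B k)) * \<mu>"
      "E (\<lambda>Y. (S k Y)^4) \<le> 3 * (real (card (B k)) * \<mu>)\<^sup>2 + real (card (B k)) * \<mu>" if "k < n" for k
  proof -
    have "finite (B k)" "B k \<subseteq> {..<n} - {k}" using B[OF that] that by (auto intro: finite_subset)
    from excess_sum_moments[OF _ _ C this] that
    show "E (\<lambda>Y. (S k Y)\<^sup>2) = real (card (B k)) * \<mu>"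
      "E (\<lambda>Y. (S k Y)^4) \<le> 3 * (real (card (B k)) * \<mu>)\<^sup>2 + real (card (B k)) * \<mu>"
      by (simp_all add: E_def M_def S_def \<mu>_def c_def)
  qed
  have D2: "E (\<lambda>Y. (D k Y)\<^sup>2) = 1 / \<sigma>\<^sup>2 * (real (card (B k)) * \<mu>)" if "k < n" for k
    unfolding D_def power_divide using E_cmult[of "1 / \<sigma>\<^sup>2" "\<lambda>Y. (S k Y)\<^sup>2"] moments(1)[OF that] by simp
  have D4: "E (\<lambda>Y. (D k Y)^4) \<le> 1 / \<sigma>^4 * (3 * (real (card (B k)) * \<mu>)\<^sup>2 + real (card (B k)) * \<mu>)" if "k < n" for k
  proof -
    have "E (\<lambda>Y. (D k Y)^4) = 1 / \<sigma>^4 * E (\<lambda>Y. (S k Y)^4)"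
      unfolding D_def power_divide using E_cmult[of "1 / \<sigma>^4" "\<lambda>Y. (S k Y)^4"] by simp
    also have "\<dots> \<le> 1 / \<sigma>^4 * (3 * (real (card (B k)) * \<mu>)\<^sup>2 + real (card (B k)) * \<mu>)"
      by (intro mult_left_mono moments(2) that) simp
    finally show ?thesis .
  qed

  have EV: "E (\<lambda>Y. \<Sum>k<n. v k Y) \<le> 1"
  proof -
    have "E (v k) = E (\<lambda>Y. (D k Y)\<^sup>2)" if "k < n" for k
    proof -
      have "measure_pmf.expectation M (\<lambda>Y. complex_of_real ((D k Y)\<^sup>2)) =
          measure_pmf.expectation M (\<lambda>Y. complex_of_real (v k Y))"
        using variance[OF that, of "\<lambda>_. 1"] by (simp add: determined_by_def del: of_real_power)
      then show ?thesis unfolding integral_complex_of_real E_def of_real_eq_iff by simp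
    qed
    then have "E (\<lambda>Y. \<Sum>k<n. v k Y) = (\<Sum>k<n. 1 / \<sigma>\<^sup>2 * (real (card (B k)) * \<mu>))"
      unfolding E_sum by (intro sum.cong) (auto simp: D2)
    also have "\<dots> = 1 / \<sigma>\<^sup>2 * (real m * \<mu>)"
      by (simp add: m_def sum_distrib_left sum_distrib_right)
    also have "\<dots> = 1 - 1 / c" using m c by (simp add: \<sigma>(2) \<mu>_def)
    also have "\<dots> \<le> 1" using c by simp
    finally show ?thesis .
  qed

  have L4: "(\<Sum>k<n. E (\<lambda>Y. (D k Y)^4)) \<le> \<delta>"
  proof -
    have d_le: "real (card (B k)) \<le> sqrt (2 * real m)" if "k < n" for k
      using deg[OF that] by (intro real_le_rsqrt) (metis of_nat_le_iff of_nat_mult of_nat_numeral of_nat_power)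
    have term_le: "3 * (real (card (B k)) * \<mu>)\<^sup>2 + real (card (B k)) * \<mu>
        \<le> (3 * sqrt (2 * real m) / c\<^sup>2 + 1 / c) * real (card (B k))" if "k < n" for k
    proof -
      have "(real (card (B k)) * \<mu>)\<^sup>2 \<le> (real (card (B k)) * (1 / c))\<^sup>2"
        using \<mu> by (intro power_mono mult_left_mono) auto
      also have "\<dots> = real (card (B k)) * real (card (B k)) / c\<^sup>2"
        by (simp add: power2_eq_square)
      also have "\<dots> \<le> sqrt (2 * real m) * real (card (B k)) / c\<^sup>2"
        using d_le[OF that] by (intro divide_right_mono mult_right_mono) auto
      finally have "3 * (real (card (B k)) * \<mu>)\<^sup>2 \<le> 3 * (sqrt (2 * real m) * real (card (B k)) / c\<^sup>2)" by simp
      moreover have "real (card (B k)) * \<mu> \<le> real (card (B k)) * (1 / c)"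
        using \<mu> by (intro mult_left_mono) auto
      ultimately show ?thesis by (simp add: distrib_right)
    qed
    have "(\<Sum>k<n. E (\<lambda>Y. (D k Y)^4)) \<le>
        (\<Sum>k<n. 1 / \<sigma>^4 * ((3 * sqrt (2 * real m) / c\<^sup>2 + 1 / c) * real (card (B k))))"
      by (intro sum_mono order_trans[OF D4 mult_left_mono[OF term_le]]) auto
    also have "\<dots> = 1 / \<sigma>^4 * ((3 * sqrt (2 * real m) / c\<^sup>2 + 1 / c) * real m)"
      by (simp add: m_def sum_distrib_left)
    also have "\<dots> = 3 * sqrt 2 / sqrt (real m) + 1 / \<sigma>\<^sup>2"
    proof -
      define s where "s = sqrt (real m)"
      have s: "s > 0" "real m = s\<^sup>2" using m by (simp_all add: s_def)
      have "\<sigma>^4 = (real m / c)\<^sup>2" using \<sigma>(2) by (metis power2_eq_square power4_eq_xxxx mult.assoc)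
      then show ?thesis unfolding \<sigma>(2) real_sqrt_mult s_def[symmetric] unfolding s(2) using s(1) c
        by (simp add: field_simps power2_eq_square power4_eq_xxxx)
    qed
    also have "\<dots> \<le> \<delta>"
    proof -
      have "sqrt 2 \<le> sqrt ((5/3)\<^sup>2)" by (intro real_sqrt_le_mono) (simp add: power2_eq_square)
      then have "3 * sqrt 2 \<le> 5" by simp
      moreover have "\<sigma> \<le> sqrt (real m)"
        unfolding \<sigma>_def using c by (intro real_sqrt_le_mono) (simp add: divide_le_eq mult_le_cancel_left1)
      ultimately have "3 * sqrt 2 / sqrt (real m) \<le> 5 / \<sigma>" using \<sigma>(1) by (intro frac_le) auto
      then show ?thesis by (simp add: \<delta>_def)
    qed
    finally show ?thesis .
  qed

  have V: "E (\<lambda>Y. \<bar>(\<Sum>k<n. v k Y) - 1\<bar>) \<le> 3 / sqrt c"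
  proof -
    define T where "T Y = (\<Sum>l<n. \<Sum>j<l. codegree B n j l * agreement_excess C j l Y)" for Y
    \<comment> \<open>The pairs with j = l contribute 1 - 1/c in total, the others a multiple of T.\<close>
    have V_eq: "(\<Sum>k<n. v k Y) - 1 = 2 / real m * T Y - 1 / c" if Y: "Y \<in> set_pmf M" for Y
    proof -
      have "v k Y = (\<Sum>j\<in>B k. \<Sum>l\<in>B k. agreement_excess C j l Y) / real m" if k: "k < n" for k
      proof -
        have "(\<Sum>a\<in>C. (S k (Y(k := a)))\<^sup>2) =
            (\<Sum>a\<in>C. \<Sum>j\<in>B k. \<Sum>l\<in>B k. (of_bool (Y j = a) - 1 / c) * (of_bool (Y l = a) - 1 / c))"
          unfolding S_upd[OF k] power2_eq_square sum_product ..
        also have "\<dots> = (\<Sum>j\<in>B k. \<Sum>a\<in>C. \<Sum>l\<in>B k. (of_bool (Y j = a) - 1 / c) * (of_bool (Y l = a) - 1 / c))"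
          by (rule sum.swap)
        also have "\<dots> = (\<Sum>j\<in>B k. \<Sum>l\<in>B k. \<Sum>a\<in>C. (of_bool (Y j = a) - 1 / c) * (of_bool (Y l = a) - 1 / c))"
          by (intro sum.cong refl sum.swap)
        also have "\<dots> = (\<Sum>j\<in>B k. \<Sum>l\<in>B k. agreement_excess C j l Y)"
          unfolding agreement_excess_def c_def
        proof (intro sum.cong refl sum_colour_excess_mult C)
          fix j l assume "j \<in> B k" "l \<in> B k"
          then show "Y j \<in> C" "Y l \<in> C" using B[OF k] k by (auto intro!: col[OF Y])
        qed
        finally have "(\<Sum>a\<in>C. (S k (Y(k := a)))\<^sup>2) = \<dots>" .
        then show ?thesis
          unfolding v_def D_def power_divide sum_divide_distrib[symmetric] \<sigma>(2) using c by simp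
      qed
      then have "(\<Sum>k<n. v k Y) = (\<Sum>k<n. \<Sum>j\<in>B k. \<Sum>l\<in>B k. agreement_excess C j l Y) / real m"
        by (simp add: sum_divide_distrib)
      also have "(\<Sum>k<n. \<Sum>j\<in>B k. \<Sum>l\<in>B k. agreement_excess C j l Y)
          = (\<Sum>j<n. codegree B n j j * agreement_excess C j j Y) + 2 * T Y"
        unfolding T_def by (rule sum_back_pairs[OF B]) (simp_all add: agreement_excess_commute)
      also have "(\<Sum>j<n. codegree B n j j * agreement_excess C j j Y) = real m * (1 - 1 / c)"
      proof -
        have "real m = (\<Sum>j<n. codegree B n j j)"
          unfolding m_def by (rule sum_codegree_diagonal[symmetric]) (rule B)
        then show ?thesis by (simp add: agreement_excess_def c_def sum_distrib_right)
      qed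
      finally show ?thesis using m c by (simp add: field_simps)
    qed
    have T2: "E (\<lambda>Y. (2 / real m * T Y)\<^sup>2) \<le> 4 / c"
    proof -
      have "E (\<lambda>Y. (T Y)\<^sup>2) = \<mu> * (\<Sum>l<n. \<Sum>j<l. (codegree B n j l)\<^sup>2)"
        unfolding E_def M_def T_def \<mu>_def c_def by (rule weighted_excess_variance[OF C])
      also have "\<dots> \<le> 1 / c * (real m)\<^sup>2"
        unfolding m_def using \<mu> c
        by (intro mult_mono sum_codegree_squares_le B) (auto intro!: sum_nonneg)
      finally have "(2 / real m)\<^sup>2 * E (\<lambda>Y. (T Y)\<^sup>2) \<le> (2 / real m)\<^sup>2 * (1 / c * (real m)\<^sup>2)"
        by (intro mult_left_mono) auto
      also have "\<dots> = 4 / c" using m by (simp add: power2_eq_square)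
      finally show ?thesis unfolding power_mult_distrib E_cmult .
    qed
    define s where "s = sqrt c"
    have s: "s \<ge> 1" "c = s * s" using c by (simp_all add: s_def)
    \<comment> \<open>The first absolute moment is at most the root of the second; the arithmetic-geometric mean
      inequality with weight s = sqrt c gives this, since the second moment is at most 4/c.\<close>
    have "E (\<lambda>Y. \<bar>(\<Sum>k<n. v k Y) - 1\<bar>) \<le> E (\<lambda>Y. (1 / c + 1 / s) + s / 4 * (2 / real m * T Y)\<^sup>2)"
    proof (rule E_mono)
      fix Y assume Y: "Y \<in> set_pmf M"
      define x where "x = 2 / real m * T Y"
      have "0 \<le> (s / 2 * \<bar>x\<bar> - 1)\<^sup>2" by simp
      also have "\<dots> = s * (s / 4 * x\<^sup>2 + 1 / s - \<bar>x\<bar>)"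
        using s(1) by (simp add: power2_eq_square field_simps flip: abs_mult)
      finally have "0 \<le> s / 4 * x\<^sup>2 + 1 / s - \<bar>x\<bar>"
        using s(1) by (simp only: zero_le_mult_iff) linarith
      moreover have "0 \<le> 1 / c" using c by simp
      ultimately show "\<bar>(\<Sum>k<n. v k Y) - 1\<bar> \<le> (1 / c + 1 / s) + s / 4 * (2 / real m * T Y)\<^sup>2"
        unfolding V_eq[OF Y] x_def[symmetric] by linarith
    qed
    also have "\<dots> = (1 / c + 1 / s) + s / 4 * E (\<lambda>Y. (2 / real m * T Y)\<^sup>2)"
      unfolding E_add E_cmult by (simp add: E_def)
    also have "\<dots> \<le> (1 / c + 1 / s) + s / 4 * (4 / c)"
      using T2 s(1) by (intro add_left_mono mult_left_mono) auto
    also have "\<dots> \<le> 3 / s" using s by (simp add: field_simps)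
    finally show ?thesis by (simp add: s_def)
  qed

  \<comment> \<open>The parameter e = sqrt \<delta> balances the two parts of the third order term.\<close>
  have "cmod (measure_pmf.expectation M (\<lambda>Y. iexp (t * (\<Sum>k<n. D k Y))) - exp (- (t\<^sup>2) / 2))
     \<le> t\<^sup>2 / 2 * E (\<lambda>Y. \<bar>(\<Sum>k<n. v k Y) - 1\<bar>)
       + \<bar>t\<bar>^3 / 12 * (sqrt \<delta> * E (\<lambda>Y. \<Sum>k<n. v k Y) + (\<Sum>k<n. E (\<lambda>Y. (D k Y)^4)) / sqrt \<delta>)
       + t^4 / 8 * (\<Sum>k<n. E (\<lambda>Y. (D k Y)^4))"
    unfolding E_def
    by (rule martingale_char_approx[OF finM adapted predictable v_nonneg centred variance]) (use \<delta> in auto)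
  also have "\<dots> \<le> t\<^sup>2 / 2 * (3 / sqrt c) + \<bar>t\<bar>^3 / 12 * (sqrt \<delta> * 1 + \<delta> / sqrt \<delta>) + t^4 / 8 * \<delta>"
    using \<delta> by (intro add_mono mult_left_mono divide_right_mono V EV L4) auto
  also have "\<dots> = 3 * t\<^sup>2 / (2 * sqrt c) + \<bar>t\<bar>^3 * sqrt \<delta> / 6 + t^4 * \<delta> / 8"
    using \<delta> by (simp add: real_div_sqrt mult.commute)
  finally show ?thesis
    unfolding M_def D_def S_def sum_divide_distrib .
qed

section \<open>Graphs with vertices revealed by decreasing degree\<close>

text \<open>
  Beyond the vertices the enumeration takes the value \<open>u\<close> outside \<open>V\<close>, so that composing a colouring
  with it gives the default colour there.
\<close>

lemma decreasing_enumeration: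
  fixes f :: "'v \<Rightarrow> nat"
  assumes "finite V" "u \<notin> V"
  obtains \<pi> where "bij_betw \<pi> {..<card V} V" "\<And>j. j \<ge> card V \<Longrightarrow> \<pi> j \<notin> V"
    "\<And>i j. i \<le> j \<Longrightarrow> j < card V \<Longrightarrow> f (\<pi> j) \<le> f (\<pi> i)"
proof -
  obtain ys where ys: "set ys = V" "distinct ys" using finite_distinct_list[OF assms(1)] by blast
  define xs where "xs = sort_key (\<lambda>v. - int (f v)) ys"
  have xs: "set xs = V" "distinct xs" "sorted (map (\<lambda>v. - int (f v)) xs)"
    using ys by (simp_all add: xs_def)
  have len: "length xs = card V" using xs distinct_card by metis
  define \<pi> where "\<pi> j = (if j < card V then xs ! j else u)" for j
  have "bij_betw ((!) xs) {..<card V} V" using xs len by (intro bij_betw_nth) auto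
  then have "bij_betw \<pi> {..<card V} V" by (rule bij_betw_cong[THEN iffD1, rotated]) (simp add: \<pi>_def)
  moreover have "f (\<pi> j) \<le> f (\<pi> i)" if "i \<le> j" "j < card V" for i j
    using sorted_nth_mono[OF xs(3), of i j] that len by (simp add: \<pi>_def)
  moreover have "\<pi> j \<notin> V" if "j \<ge> card V" for j using that assms by (simp add: \<pi>_def)
  ultimately show ?thesis using that by blast
qed

definition back_neighbours :: "'v set set \<Rightarrow> (nat \<Rightarrow> 'v) \<Rightarrow> nat \<Rightarrow> nat set" where
  "back_neighbours E \<pi> k = {j. j < k \<and> {\<pi> j, \<pi> k} \<in> E}"

definition vertex_degree :: "'v set set \<Rightarrow> 'v \<Rightarrow> nat" where
  "vertex_degree E v = card {e \<in> E. v \<in> e}"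

lemma finite_edges: "finite V \<Longrightarrow> E \<subseteq> {e. e \<subseteq> V \<and> card e = 2} \<Longrightarrow> finite E"
  by (rule finite_subset[of _ "Pow V"]) auto

lemma handshake:
  assumes "finite V" "E \<subseteq> {e. e \<subseteq> V \<and> card e = 2}"
  shows "(\<Sum>v\<in>V. vertex_degree E v) = 2 * card E"
proof -
  note finE = finite_edges[OF assms]
  have "(\<Sum>v\<in>V. vertex_degree E v) = (\<Sum>v\<in>V. \<Sum>e\<in>E. of_bool (v \<in> e))"
    unfolding vertex_degree_def using finE by (intro sum.cong refl) (simp add: Int_def)
  also have "\<dots> = (\<Sum>e\<in>E. \<Sum>v\<in>V. of_bool (v \<in> e))" by (rule sum.swap)
  also have "\<dots> = (\<Sum>e\<in>E. 2)"
  proof (rule sum.cong[OF refl])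
    fix e assume "e \<in> E"
    then have "e \<subseteq> V" "card e = 2" using assms by auto
    then show "(\<Sum>v\<in>V. of_bool (v \<in> e)) = (2::nat)" using assms by (simp add: Int_absorb1)
  qed
  finally show ?thesis by simp
qed

lemma bij_betw_back_edges:
  assumes \<pi>: "bij_betw \<pi> {..<n} V" and E: "E \<subseteq> {e. e \<subseteq> V \<and> card e = 2}"
  shows "bij_betw (\<lambda>(k, j). {\<pi> j, \<pi> k}) (SIGMA k:{..<n}. back_neighbours E \<pi> k) E"
proof (rule bij_betw_imageI)
  have inj: "i = j" if "\<pi> i = \<pi> j" "i < n" "j < n" for i j
    using \<pi> that by (auto simp: bij_betw_def inj_on_def)
  show "inj_on (\<lambda>(k, j). {\<pi> j, \<pi> k}) (SIGMA k:{..<n}. back_neighbours E \<pi> k)"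
  proof (rule inj_onI)
    fix p p'
    assume "p \<in> (SIGMA k:{..<n}. back_neighbours E \<pi> k)" "p' \<in> (SIGMA k:{..<n}. back_neighbours E \<pi> k)"
      and "(case p of (k, j) \<Rightarrow> {\<pi> j, \<pi> k}) = (case p' of (k, j) \<Rightarrow> {\<pi> j, \<pi> k})"
    then obtain k j k' j' where p: "p = (k, j)" "p' = (k', j')"
      and a: "k \<in> {..<n}" "k' \<in> {..<n}" "j \<in> back_neighbours E \<pi> k" "j' \<in> back_neighbours E \<pi> k'"
      and eq: "{\<pi> j, \<pi> k} = {\<pi> j', \<pi> k'}" by (cases p; cases p') auto
    then have lt: "j < k" "k < n" "j' < k'" "k' < n" by (auto simp: back_neighbours_def)
    from eq consider "\<pi> j = \<pi> j'" "\<pi> k = \<pi> k'" | "\<pi> j = \<pi> k'" "\<pi> k = \<pi> j'"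
      by (auto simp: doubleton_eq_iff)
    then have "k = k' \<and> j = j'"
      using inj lt by cases (metis order.strict_trans less_asym)+
    then show "p = p'" by (simp add: p)
  qed
  show "(\<lambda>(k, j). {\<pi> j, \<pi> k}) ` (SIGMA k:{..<n}. back_neighbours E \<pi> k) = E"
  proof (rule set_eqI, rule iffI)
    fix e assume e: "e \<in> E"
    then obtain x y where xy: "e = {x, y}" "x \<noteq> y" "x \<in> V" "y \<in> V"
      using E by (auto simp: card_2_iff)
    then obtain i j where ij: "i < n" "j < n" "x = \<pi> i" "y = \<pi> j"
      using \<pi> by (auto simp: bij_betw_def)
    then have "i < j \<or> j < i" using xy by (metis linorder_less_linear)
    then show "e \<in> (\<lambda>(k, j). {\<pi> j, \<pi> k}) ` (SIGMA k:{..<n}. back_neighbours E \<pi> k)"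
      using e xy ij by (force simp: back_neighbours_def insert_commute image_iff)
  qed (auto simp: back_neighbours_def)
qed

lemma sum_back_edges:
  assumes "bij_betw \<pi> {..<n} V" "E \<subseteq> {e. e \<subseteq> V \<and> card e = 2}"
  shows "(\<Sum>k<n. \<Sum>j\<in>back_neighbours E \<pi> k. F {\<pi> j, \<pi> k}) = (\<Sum>e\<in>E. F e)"
proof -
  have "finite (back_neighbours E \<pi> k)" for k by (simp add: back_neighbours_def)
  then have "(\<Sum>k<n. \<Sum>j\<in>back_neighbours E \<pi> k. F {\<pi> j, \<pi> k}) =
    (\<Sum>p\<in>(SIGMA k:{..<n}. back_neighbours E \<pi> k). F ((\<lambda>(k, j). {\<pi> j, \<pi> k}) p))"
    by (subst sum.Sigma) (auto simp: case_prod_beta)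
  then show ?thesis
    using sum.reindex_bij_betw[OF bij_betw_back_edges[OF assms], of F] by simp
qed

text \<open>
  Every neighbour that precedes \<open>k\<close> has at least the degree of \<open>k\<close>, hence at least as many edges
  as \<open>k\<close> has earlier neighbours; sum this over the earlier neighbours and use the handshake lemma.
\<close>

lemma back_degree_square_le:
  assumes "finite V" and E: "E \<subseteq> {e. e \<subseteq> V \<and> card e = 2}" and \<pi>: "bij_betw \<pi> {..<n} V"
    and mono: "\<And>i j. i \<le> j \<Longrightarrow> j < n \<Longrightarrow> vertex_degree E (\<pi> j) \<le> vertex_degree E (\<pi> i)" and k: "k < n"
  shows "(card (back_neighbours E \<pi> k))\<^sup>2 \<le> 2 * card E"
proof -
  let ?B = "back_neighbours E \<pi> k"
  have B: "?B \<subseteq> {..<k}" by (auto simp: back_neighbours_def)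
  have "card ?B \<le> vertex_degree E (\<pi> k)"
    unfolding vertex_degree_def
  proof (rule card_inj_on_le)
    have inj: "inj_on \<pi> {..<n}" using \<pi> by (simp add: bij_betw_def)
    show "inj_on (\<lambda>j. {\<pi> j, \<pi> k}) ?B"
    proof (rule inj_onI)
      fix i j assume ij: "i \<in> ?B" "j \<in> ?B" "{\<pi> i, \<pi> k} = {\<pi> j, \<pi> k}"
      then have "\<pi> i = \<pi> j" by (auto simp: doubleton_eq_iff)
      then show "i = j" using inj_onD[OF inj] ij B k by (meson lessThan_iff order.strict_trans subset_iff)
    qed
    show "(\<lambda>j. {\<pi> j, \<pi> k}) ` ?B \<subseteq> {e \<in> E. \<pi> k \<in> e}" by (auto simp: back_neighbours_def)
    show "finite {e \<in> E. \<pi> k \<in> e}" using finite_edges[OF assms(1) E] by simp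
  qed
  then have "card ?B \<le> vertex_degree E (\<pi> j)" if "j \<in> ?B" for j
    using mono[of j k] that B k by force
  then have "(\<Sum>j\<in>?B. card ?B) \<le> (\<Sum>j\<in>?B. vertex_degree E (\<pi> j))" by (rule sum_mono)
  also have "\<dots> \<le> (\<Sum>j<n. vertex_degree E (\<pi> j))"
    using B k by (intro sum_mono2) auto
  also have "\<dots> = (\<Sum>v\<in>V. vertex_degree E v)" by (rule sum.reindex_bij_betw[OF \<pi>])
  finally show ?thesis by (simp add: handshake[OF assms(1) E] power2_eq_square)
qed

text \<open>
  The part of the bound that depends on \<open>x = m / c\<close>, the mean number of monochromatic edges.
\<close>

definition char_error :: "real \<Rightarrow> real \<Rightarrow> real" where
  "char_error t x = (let \<delta> = 5 / sqrt x + 1 / x in \<bar>t\<bar>^3 * sqrt \<delta> / 6 + t^4 * \<delta> / 8)"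

lemma char_error_antimono:
  assumes "0 < x" "x \<le> y"
  shows "char_error t y \<le> char_error t x"
proof -
  have "5 / sqrt y + 1 / y \<le> 5 / sqrt x + 1 / x"
    using assms by (intro add_mono frac_le) auto
  moreover have "\<bar>t\<bar>^3 * sqrt a / 6 + t^4 * a / 8 \<le> \<bar>t\<bar>^3 * sqrt b / 6 + t^4 * b / 8"
    if "a \<le> b" for a b
    using that by (intro add_mono divide_right_mono mult_left_mono) auto
  ultimately show ?thesis unfolding char_error_def Let_def by blast
qed

lemma char_error_tendsto: "(char_error t \<longlongrightarrow> 0) at_top"
proof -
  have "((\<lambda>x::real. 5 / sqrt x + 1 / x) \<longlongrightarrow> 0) at_top" by real_asymp
  then have "((\<lambda>x. \<bar>t\<bar>^3 * sqrt (5 / sqrt x + 1 / x) / 6 + t^4 * (5 / sqrt x + 1 / x) / 8)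
      \<longlongrightarrow> \<bar>t\<bar>^3 * sqrt 0 / 6 + t^4 * 0 / 8) at_top"
    by (intro tendsto_intros) simp_all
  then show ?thesis by (simp add: char_error_def[abs_def] Let_def)
qed

text \<open>
  Reading the colours in the order of the enumeration turns the uniform colouring of the vertices into
  independent uniform colours on \<open>{..<n}\<close> and the edges into pairs of a vertex and an earlier neighbour.
\<close>

lemma graph_char_bound:
  assumes E: "E \<in> simple_graphs n" "E \<noteq> {}" and c: "c > 0"
  shows "cmod (measure_pmf.expectation (uniform_colouring n c)
      (\<lambda>Y. iexp (t * normalised_mono_edges c (E, Y))) - exp (- (t\<^sup>2) / 2))
    \<le> 3 * t\<^sup>2 / (2 * sqrt (real c)) + char_error t (real (card E) / real c)"
proof -
  have E2: "E \<subseteq> {e. e \<subseteq> {1..n} \<and> card e = 2}" using E by (simp add: simple_graphs_def)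
  have finE: "finite E" by (rule finite_edges[OF _ E2]) simp
  obtain \<pi> where \<pi>: "bij_betw \<pi> {..<n} {1..n}" and out: "\<And>j. j \<ge> n \<Longrightarrow> \<pi> j \<notin> {1..n}"
    and mono: "\<And>i j. i \<le> j \<Longrightarrow> j < n \<Longrightarrow> vertex_degree E (\<pi> j) \<le> vertex_degree E (\<pi> i)"
    using decreasing_enumeration[of "{1..n}" 0 "vertex_degree E"] by auto
  define B where "B = back_neighbours E \<pi>"
  define \<sigma> where "\<sigma> = sqrt (real (card E) / real c)"
  note sum_edges = sum_back_edges[OF \<pi> E2, folded B_def]
  have cardE: "(\<Sum>k<n. card (B k)) = card E" using sum_edges[of "\<lambda>_. 1::nat"] by simp
  have "iid_colours {..<n} {1..c} = map_pmf (\<lambda>Y. Y \<circ> \<pi>) (uniform_colouring n c)"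
    unfolding iid_colours_def uniform_colouring_def
    using \<pi> out by (intro Pi_pmf_bij_betw) auto
  then have transfer: "measure_pmf.expectation (iid_colours {..<n} {1..c}) f
      = measure_pmf.expectation (uniform_colouring n c) (\<lambda>Y. f (Y \<circ> \<pi>))" for f :: "_ \<Rightarrow> complex"
    by simp
  have W: "normalised_mono_edges c (E, Y) =
      (\<Sum>k<n. \<Sum>j\<in>B k. agreement_excess {1..c} j k (Y \<circ> \<pi>)) / \<sigma>" for Y
  proof -
    have "real (mono_edges E Y) - real (card E) / real c
        = (\<Sum>e\<in>E. of_bool (\<forall>i\<in>e. \<forall>j\<in>e. Y i = Y j) - 1 / real c)"
      by (simp add: mono_edges_def sum_subtractf)
    also have "\<dots> = (\<Sum>k<n. \<Sum>j\<in>B k.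
        of_bool (\<forall>i\<in>{\<pi> j, \<pi> k}. \<forall>i'\<in>{\<pi> j, \<pi> k}. Y i = Y i') - 1 / real c)"
      by (rule sum_edges[symmetric])
    also have "\<dots> = (\<Sum>k<n. \<Sum>j\<in>B k. agreement_excess {1..c} j k (Y \<circ> \<pi>))"
      unfolding agreement_excess_def by (intro sum.cong refl arg_cong2[of _ _ _ _ "(-)"] arg_cong[of _ _ of_bool]) auto
    finally show ?thesis by (simp add: normalised_mono_edges_def \<sigma>_def)
  qed
  have "cmod (measure_pmf.expectation (iid_colours {..<n} {1..c})
      (\<lambda>Y. iexp (t * ((\<Sum>k<n. \<Sum>j\<in>B k. agreement_excess {1..c} j k Y)
        / sqrt (real (\<Sum>k<n. card (B k)) / real (card {1..c}))))) - exp (- (t\<^sup>2) / 2))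
    \<le> 3 * t\<^sup>2 / (2 * sqrt (real (card {1..c})))
      + \<bar>t\<bar>^3 * sqrt (5 / sqrt (real (\<Sum>k<n. card (B k)) / real (card {1..c}))
          + 1 / (sqrt (real (\<Sum>k<n. card (B k)) / real (card {1..c})))\<^sup>2) / 6
      + t^4 * (5 / sqrt (real (\<Sum>k<n. card (B k)) / real (card {1..c}))
          + 1 / (sqrt (real (\<Sum>k<n. card (B k)) / real (card {1..c})))\<^sup>2) / 8"
  proof (rule back_neighbour_char_bound)
    show "B k \<subseteq> {..<k}" for k by (auto simp: B_def back_neighbours_def)
    show "0 < (\<Sum>k<n. card (B k))" unfolding cardE using E finE by (simp add: card_gt_0_iff)
    show "(card (B k))\<^sup>2 \<le> 2 * (\<Sum>k<n. card (B k))" if "k < n" for k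
      unfolding cardE unfolding B_def by (rule back_degree_square_le[OF _ E2 \<pi> mono that]) simp_all
  qed (use c in auto)
  then show ?thesis
    unfolding cardE transfer W \<sigma>_def char_error_def Let_def by simp
qed

section \<open>Random graphs and the limit\<close>

lemma expectation_pair_pmf_finite:
  fixes f :: "'a \<times> 'b \<Rightarrow> 'c::{banach, second_countable_topology}"
  assumes "finite (set_pmf p)" "finite (set_pmf q)"
  shows "measure_pmf.expectation (pair_pmf p q) f =
    measure_pmf.expectation p (\<lambda>x. measure_pmf.expectation q (\<lambda>y. f (x, y)))"
proof -
  have "pair_pmf p q = p \<bind> (\<lambda>x. map_pmf (Pair x) q)" by (simp add: pair_pmf_def map_pmf_def)
  then show ?thesis
    using assms by (simp add: pmf_expectation_bind[of "set_pmf p"] integral_measure_pmf[of "set_pmf p" p])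
qed

text \<open>
  Conditionally on the graph the previous bound applies when \<open>m / c > K\<close>; on the remaining event two
  numbers of modulus at most \<open>1\<close> are compared, which also covers the graph without edges.
\<close>

lemma random_graph_char_bound:
  assumes G: "set_pmf G \<subseteq> simple_graphs n" and c: "c > 0" and K: "K > 0"
  shows "cmod (char (distr (measure_pmf (coloured_graph G n c)) borel (normalised_mono_edges c)) t
      - exp (- (t\<^sup>2) / 2))
    \<le> 3 * t\<^sup>2 / (2 * sqrt (real c)) + char_error t K
      + 2 * (1 - measure_pmf.prob G {E. real (card E) / real c > K})"
proof -
  define \<phi> where "\<phi> E = measure_pmf.expectation (uniform_colouring n c)
      (\<lambda>Y. iexp (t * normalised_mono_edges c (E, Y)))" for E
  define b where "b = 3 * t\<^sup>2 / (2 * sqrt (real c)) + char_error t K"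
  define A where "A = {E :: nat set set. real (card E) / real c > K}"
  have b: "b \<ge> 0" using K by (simp add: b_def char_error_def Let_def)
  have finG: "finite (set_pmf G)"
    by (rule finite_subset[OF G]) (simp add: simple_graphs_def)
  have finU: "finite (set_pmf (uniform_colouring n c))"
    using finite_iid_colours[of "{1..n}" "{1..c}"] c by (simp add: iid_colours_def uniform_colouring_def)
  have int: "integrable (measure_pmf G) f" for f :: "_ \<Rightarrow> complex"
    by (rule integrable_measure_pmf_finite[OF finG])
  have intr: "integrable (measure_pmf G) f" for f :: "_ \<Rightarrow> real"
    by (rule integrable_measure_pmf_finite[OF finG])
  have "char (distr (measure_pmf (coloured_graph G n c)) borel (normalised_mono_edges c)) t
      = measure_pmf.expectation (coloured_graph G n c) (\<lambda>x. iexp (t * normalised_mono_edges c x))"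
    unfolding char_def by (subst integral_distr) auto
  also have "\<dots> = measure_pmf.expectation G \<phi>"
    unfolding coloured_graph_def \<phi>_def by (rule expectation_pair_pmf_finite[OF finG finU])
  finally have "cmod (char (distr (measure_pmf (coloured_graph G n c)) borel (normalised_mono_edges c)) t
      - exp (- (t\<^sup>2) / 2)) = cmod (measure_pmf.expectation G (\<lambda>E. \<phi> E - exp (- (t\<^sup>2) / 2)))"
    by (simp add: int)
  also have "\<dots> \<le> measure_pmf.expectation G (\<lambda>E. cmod (\<phi> E - exp (- (t\<^sup>2) / 2)))"
    by (rule integral_norm_bound)
  also have "\<dots> \<le> measure_pmf.expectation G (\<lambda>E. b + 2 * (1 - indicator A E))"
  proof (rule integral_mono_AE[OF intr intr AE_pmfI])
    fix E assume "E \<in> set_pmf G"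
    then have E: "E \<in> simple_graphs n" using G by auto
    show "cmod (\<phi> E - exp (- (t\<^sup>2) / 2)) \<le> b + 2 * (1 - indicator A E)"
    proof (cases "E \<in> A")
      case True
      then have K_le: "K < real (card E) / real c" by (simp add: A_def)
      then have "E \<noteq> {}" using K by auto
      from graph_char_bound[OF E this c, of t] char_error_antimono[OF K, of "real (card E) / real c" t] K_le True
      show ?thesis by (simp add: \<phi>_def b_def)
    next
      case False
      have "cmod (\<phi> E) \<le> measure_pmf.expectation (uniform_colouring n c) (\<lambda>Y. 1)"
        unfolding \<phi>_def by (rule order_trans[OF integral_norm_bound]) simp
      then have "cmod (\<phi> E) \<le> 1" by simp
      moreover have "exp (- (t\<^sup>2) / 2) \<le> 1" by simp
      ultimately have "cmod (\<phi> E - exp (- (t\<^sup>2) / 2)) \<le> 2"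
        using norm_triangle_ineq4[of "\<phi> E" "of_real (exp (- (t\<^sup>2) / 2))"]
        by (simp only: norm_of_real abs_exp_cancel)
      then show ?thesis using False b by simp
    qed
  qed
  also have "\<dots> = b + 2 * (1 - measure_pmf.prob G A)"
    by (simp add: intr)
  finally show ?thesis by (simp add: b_def A_def)
qed

theorem theorem1p2:
  fixes G :: "nat \<Rightarrow> nat set set pmf" and c :: "nat \<Rightarrow> nat"
  assumes "\<And>n. n \<ge> 1 \<Longrightarrow> set_pmf (G n) \<subseteq> simple_graphs n"
    and "\<And>n. n \<ge> 1 \<Longrightarrow> c n > 0"
    and "filterlim c at_top sequentially"
    and "tends_to_infinity_in_prob G (\<lambda>n E. real (card E) / real (c n))"
  shows "weak_conv_m
    (\<lambda>n. distr (measure_pmf (coloured_graph (G n) n (c n))) borel (normalised_mono_edges (c n)))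
    std_normal_distribution"
proof (rule levy_continuity)
  show "real_distribution (distr (measure_pmf (coloured_graph (G n) n (c n))) borel (normalised_mono_edges (c n)))" for n
    by (rule prob_space.real_distribution_distr) (auto intro: prob_space_measure_pmf)
  show "real_distribution std_normal_distribution" by (rule real_dist_normal_dist)
  fix t :: real
  define \<psi> where "\<psi> n = char (distr (measure_pmf (coloured_graph (G n) n (c n))) borel (normalised_mono_edges (c n))) t" for n
  define r where "r K n = 3 * t\<^sup>2 / (2 * sqrt (real (c n)))
      + 2 * (1 - measure_pmf.prob (G n) {E. real (card E) / real (c n) > K})" for K n
  have bound: "cmod (\<psi> n - exp (- (t\<^sup>2) / 2)) \<le> r K n + char_error t K" if "n \<ge> 1" "K > 0" for n K
    using random_graph_char_bound[OF assms(1,2) that(2), OF that(1) that(1), of t]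
    by (simp add: \<psi>_def r_def)
  have r: "r K \<longlonglongrightarrow> 0" for K
  proof -
    have "(\<lambda>n. measure_pmf.prob (G n) {E. real (card E) / real (c n) > K}) \<longlonglongrightarrow> 1"
      using assms(4) by (simp add: tends_to_infinity_in_prob_def)
    moreover have "(\<lambda>n. 3 * t\<^sup>2 / (2 * sqrt (real (c n)))) \<longlonglongrightarrow> 0"
    proof -
      have "((\<lambda>x. 3 * t\<^sup>2 / (2 * sqrt x)) \<longlongrightarrow> 0) at_top" by real_asymp
      from filterlim_compose[OF this filterlim_compose[OF filterlim_real_sequentially assms(3)]]
      show ?thesis .
    qed
    ultimately have "r K \<longlonglongrightarrow> 0 + 2 * (1 - 1)"
      unfolding r_def[abs_def] by (intro tendsto_intros)
    then show ?thesis by simp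
  qed
  \<comment> \<open>First fix the threshold K for the error char_error, then let n tend to infinity.\<close>
  have "\<psi> \<longlonglongrightarrow> exp (- (t\<^sup>2) / 2)"
  proof (rule LIMSEQ_I)
    fix \<epsilon> :: real assume "\<epsilon> > 0"
    then have "\<forall>\<^sub>F K in at_top. char_error t K < \<epsilon> / 2"
      by (intro order_tendstoD[OF char_error_tendsto]) simp
    then have "\<forall>\<^sub>F K in at_top. K > 0 \<and> char_error t K < \<epsilon> / 2"
      by (intro eventually_conj eventually_gt_at_top)
    then obtain K where K: "K > 0" "char_error t K < \<epsilon> / 2"
      using eventually_happens'[OF trivial_limit_at_top_linorder] by blast
    have "\<forall>\<^sub>F n in sequentially. r K n < \<epsilon> / 2"
      using \<open>\<epsilon> > 0\<close> by (intro order_tendstoD[OF r]) simp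
    then have "\<forall>\<^sub>F n in sequentially. norm (\<psi> n - exp (- (t\<^sup>2) / 2)) < \<epsilon>"
      using eventually_ge_at_top[of 1]
    proof eventually_elim
      case (elim n)
      then show ?case using bound[OF elim(2) K(1)] K(2) by linarith
    qed
    then show "\<exists>N. \<forall>n\<ge>N. norm (\<psi> n - exp (- (t\<^sup>2) / 2)) < \<epsilon>"
      by (simp add: eventually_sequentially)
  qed
  then show "(\<lambda>n. char (distr (measure_pmf (coloured_graph (G n) n (c n))) borel (normalised_mono_edges (c n))) t)
      \<longlonglongrightarrow> char std_normal_distribution t"
    by (simp add: \<psi>_def[abs_def] char_std_normal_distribution)
qed

end
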